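(* Let $n\ge0$ and let $m\geq 2$ be even. For any fixed choice of square roots $\sqrt{x_1},\dots,\sqrt{x_m}$, with $\sqrt{x_ix_j}=\sqrt{x_i}\sqrt{x_j}$, $$P_n(x_1,\dots,x_m)=\prod_{1\le i<j\le m}\frac{\sqrt{x_i}+\sqrt{x_j}}{1+\sqrt{x_ix_j}}\ \operatorname{pfaff}_{1\le i,j\le m}\left(\frac{1+\sqrt{x_ix_j}}{\sqrt{x_i}+\sqrt{x_j}}\,P_n(x_i,x_j)\right),$$ as an identity of rational functions in $\sqrt{x_1},\dots,\sqrt{x_m}$.
   Context: $q$ is a generic complex parameter: $q\neq 0$ and $q$ is not a root of unity. $(a;q)_k=(1-a)(1-aq)\cdots(1-aq^{k-1})$ and $(a_1,\dots,a_r;q)_k=(a_1;q)_k\cdots(a_r;q)_k$. For integers $n\ge 0$, $m\ge1$, $$P_n(x_1,\dots,x_m)=\frac{(-q;q)_n^m}{(q;q)_n^m}\sum_{k_1,\dots,k_m=0}^n\ \prod_{1\le i<j\le m}\frac{q^{k_j}-q^{k_i}}{q^{k_j}+q^{k_i}}\prod_{i=1}^m\frac{(-q,q^{-n};q)_{k_i}}{(q,-q^{-n};q)_{k_i}}\,x_i^{k_i}.$$ $P_n(x_i,x_j)$ is the two-variable case; it is antisymmetric. The pfaffian of a skew-symmetric $2r\times 2r$ matrix is $\operatorname{pfaff}(a_{ij})=\frac{1}{2^r r!}\sum_{\sigma\in S_{2r}}\operatorname{sgn}(\sigma)\prod_{i=1}^r a_{\sigma(2i-1),\sigma(2i)}$.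 *)

theory Defs
  imports Complex_Main "HOL-Library.FuncSet" "HOL-Combinatorics.Permutations"
begin

definition qpoch :: "complex \<Rightarrow> complex \<Rightarrow> nat \<Rightarrow> complex" where
  "qpoch a q k = (\<Prod>j<k. 1 - a * q ^ j)"

text \<open>The value of \<open>P\<^sub>n(x\<^sub>1, \<dots>, x\<^sub>m)\<close>. The variables are the values of \<open>x\<close> on \<open>{1..m}\<close>;
  values of \<open>x\<close> outside this range are irrelevant.\<close>

definition P :: "complex \<Rightarrow> nat \<Rightarrow> nat \<Rightarrow> (nat \<Rightarrow> complex) \<Rightarrow> complex" where
  "P q n m x =
     qpoch (-q) q n ^ m / qpoch q q n ^ m *
     (\<Sum>k \<in> {1..m} \<rightarrow>\<^sub>E {0..n}.
        (\<Prod>i\<in>{1..m}. \<Prod>j\<in>{i<..m}. (q ^ k j - q ^ k i) / (q ^ k j + q ^ k i)) *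
        (\<Prod>i\<in>{1..m}.
           (qpoch (-q) q (k i) * qpoch (q powi (- int n)) q (k i)) /
           (qpoch q q (k i) * qpoch (- (q powi (- int n))) q (k i)) * x i ^ k i))"

definition P2 :: "complex \<Rightarrow> nat \<Rightarrow> complex \<Rightarrow> complex \<Rightarrow> complex" where
  "P2 q n u v = P q n 2 (\<lambda>i. if i = 1 then u else v)"

text \<open>The pfaffian of the \<open>2r \<times> 2r\<close> matrix with entries \<open>a i j\<close>, \<open>i, j \<in> {1..2r}\<close>. Only
  off-diagonal entries enter the formula.\<close>

definition pfaff :: "nat \<Rightarrow> (nat \<Rightarrow> nat \<Rightarrow> complex) \<Rightarrow> complex" where
  "pfaff r a =
     1 / (2 ^ r * fact r) *
     (\<Sum>\<sigma> | \<sigma> permutes {1..2 * r}.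
        of_int (sign \<sigma>) * (\<Prod>i\<in>{1..r}. a (\<sigma> (2 * i - 1)) (\<sigma> (2 * i))))"

end

theory Submission
  imports Defs
begin

text \<open>
  Write \<open>C\<^sub>k\<close> for the factor that accompanies \<open>x\<^sub>i\<^sup>k\<close> in the second product (\<open>P_coeff\<close> below). Schur's pfaffian
  identity (\<open>schur_pfaffian\<close>) turns the factor \<open>\<Prod> (z\<^sub>j - z\<^sub>i) / (z\<^sub>j + z\<^sub>i)\<close> with \<open>z\<^sub>i = q\<^bsup>k\<^sub>i\<^esup>\<close> into a pfaffian.
  Its summands involve each index exactly once, so the multiple sum splits into double sums and
  \<open>P\<^sub>n(x\<^sub>1, \<dots>, x\<^sub>m) = pfaff (P\<^sub>n(x\<^sub>i, x\<^sub>j))\<close> (\<open>P_eq_pfaff_P2\<close>). It remains to see why inserting the kernel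
  \<open>(1 + s\<^sub>i s\<^sub>j) / (s\<^sub>i + s\<^sub>j)\<close>, where \<open>s\<^sub>i\<^sup>2 = x\<^sub>i\<close>, only multiplies this pfaffian by the product of the kernel.

  The structural fact is a formula of Christoffel-Darboux type (\<open>P2_christoffel_darboux\<close>):
  \<open>(1 - u v) P\<^sub>n(u, v) = f(u) g(v) - f(v) g(u)\<close>. It holds because the first-order recurrence of \<open>C\<^sub>k\<close> makes
  \<open>C\<^sub>k C\<^sub>l - C\<^bsub>k-1\<^esub> C\<^bsub>l-1\<^esub>\<close> divisible by \<open>q\<^sup>k + q\<^sup>l\<close>, and the quotient times \<open>q\<^sup>l - q\<^sup>k\<close> has rank two.

  With \<open>w = (1 + s\<^sup>2) / (1 - s\<^sup>2)\<close> and \<open>v = 2 s / (1 - s\<^sup>2)\<close> the numbers \<open>1 - x\<^sub>i x\<^sub>j\<close> and \<open>(s\<^sub>i + s\<^sub>j) (1 - s\<^sub>i s\<^sub>j)\<close> become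
  \<open>w\<^sub>i + w\<^sub>j\<close> and \<open>v\<^sub>i + v\<^sub>j\<close> up to a common factor \<open>2 / ((1 - x\<^sub>i) (1 - x\<^sub>j))\<close>, and the kernel is \<open>(w\<^sub>i + w\<^sub>j) / (v\<^sub>i + v\<^sub>j)\<close>.
  Since \<open>w\<^sup>2 - v\<^sup>2 = 1\<close>, everything follows from a general fact (\<open>pfaff_rank_two_change_weights\<close>): the product of
  \<open>\<Prod> (w\<^sub>i + w\<^sub>j)\<close> and \<open>pfaff ((f\<^sub>i g\<^sub>j - f\<^sub>j g\<^sub>i) / (w\<^sub>i + w\<^sub>j))\<close> depends on the \<open>w\<^sub>i\<close> only through the differences
  \<open>w\<^sub>i\<^sup>2 - w\<^sub>j\<^sup>2\<close>.

  Both this fact and Schur's identity are proved by Gaussian elimination of the last two rows and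
  columns (\<open>pfaff_eliminate_last_pair\<close>): in both cases the Schur complement is, up to a diagonal rescaling,
  a matrix of the same shape, so induction applies. Vanishing pivots in the rank-two case, and the points where
  \<open>s\<^sub>i s\<^sub>j = 1\<close>, are reached as limits of generic points.
\<close>

section \<open>Pfaffians under permutations, scaling and row operations\<close>

lemma pairs_prod:
  fixes h :: "nat \<Rightarrow> 'a::comm_monoid_mult"
  shows "(\<Prod>i\<in>{1..r}. h (2 * i - 1) * h (2 * i)) = prod h {1..2 * r}"
  by (induction r) (auto simp: atLeastAtMostSuc_conv mult_ac)

lemma pfaff_cong:
  assumes "\<And>i j. i \<in> {1..2 * r} \<Longrightarrow> j \<in> {1..2 * r} \<Longrightarrow> i \<noteq> j \<Longrightarrow> A i j = B i j"
  shows "pfaff r A = pfaff r B"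
proof -
  have "A (\<sigma> (2 * i - 1)) (\<sigma> (2 * i)) = B (\<sigma> (2 * i - 1)) (\<sigma> (2 * i))"
    if "\<sigma> permutes {1..2 * r}" "i \<in> {1..r}" for \<sigma> i
  proof (rule assms)
    show "\<sigma> (2 * i - 1) \<in> {1..2 * r}" "\<sigma> (2 * i) \<in> {1..2 * r}"
      using that(2) unfolding permutes_in_image[OF that(1)] by auto
    show "\<sigma> (2 * i - 1) \<noteq> \<sigma> (2 * i)"
      using that(2) inj_eq[OF permutes_inj[OF that(1)]] by auto
  qed
  then show ?thesis
    unfolding pfaff_def by (intro arg_cong2[where f = "(*)"] refl sum.cong prod.cong) auto
qed

text \<open>Every summand contains each index exactly once, as a row or as a column index.\<close>

lemma pfaff_scale:
  "pfaff r (\<lambda>i j. d i * d j * A i j) = prod d {1..2 * r} * pfaff r A"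
proof -
  have "(\<Prod>i\<in>{1..r}. d (\<sigma> (2 * i - 1)) * d (\<sigma> (2 * i))) = prod d {1..2 * r}"
    if "\<sigma> permutes {1..2 * r}" for \<sigma>
    using pairs_prod[of "d \<circ> \<sigma>" r] prod.permute[OF that, of d] by simp
  then have "(\<Sum>\<sigma> | \<sigma> permutes {1..2 * r}. of_int (sign \<sigma>) *
      (\<Prod>i\<in>{1..r}. d (\<sigma> (2 * i - 1)) * d (\<sigma> (2 * i)) * A (\<sigma> (2 * i - 1)) (\<sigma> (2 * i)))) =
    (\<Sum>\<sigma> | \<sigma> permutes {1..2 * r}. prod d {1..2 * r} *
      (of_int (sign \<sigma>) * (\<Prod>i\<in>{1..r}. A (\<sigma> (2 * i - 1)) (\<sigma> (2 * i)))))"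
    by (intro sum.cong refl) (simp only: prod.distrib mem_Collect_eq mult.left_commute)
  then show ?thesis
    unfolding pfaff_def by (simp only: sum_distrib_left[symmetric]) simp
qed

lemma pfaff_permute:
  assumes \<tau>: "\<tau> permutes {1..2 * r}"
  shows "pfaff r A = of_int (sign \<tau>) * pfaff r (\<lambda>i j. A (\<tau> i) (\<tau> j))"
proof -
  have "sign (\<tau> \<circ> \<sigma>) = sign \<tau> * sign \<sigma>" if "\<sigma> permutes {1..2 * r}" for \<sigma>
    using that \<tau> by (intro sign_compose) (auto intro: permutes_imp_permutation)
  then show ?thesis
    unfolding pfaff_def by (subst setum_permutations_compose_left[OF \<tau>]) (simp add: sum_distrib_left mult_ac)
qed

text \<open>Exchanging the two indices fixes the matrix and changes the sign of the pfaffian.\<close>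

lemma pfaff_equal_rows:
  assumes "i \<in> {1..2 * r}" "j \<in> {1..2 * r}" "i \<noteq> j"
    and "A i j = 0" "A j i = 0"
    and "\<And>k. k \<in> {1..2 * r} \<Longrightarrow> k \<noteq> i \<Longrightarrow> k \<noteq> j \<Longrightarrow> A i k = A j k \<and> A k i = A k j"
  shows "pfaff r A = 0"
proof -
  have "pfaff r A = of_int (sign (transpose i j)) * pfaff r (\<lambda>k l. A (transpose i j k) (transpose i j l))"
    using assms(1,2) by (intro pfaff_permute permutes_swap_id)
  also have "pfaff r (\<lambda>k l. A (transpose i j k) (transpose i j l)) = pfaff r A"
    using assms by (intro pfaff_cong) (auto simp: transpose_def)
  finally show ?thesis using assms(3) by (simp add: sign_swap_id)
qed

text \<open>The column is overwritten together with the row, with the opposite sign, so that skew symmetry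
  is preserved. The diagonal entry, which the pfaffian never reads, is \<open>v j\<close>.\<close>

definition replace_row :: "nat \<Rightarrow> (nat \<Rightarrow> complex) \<Rightarrow> (nat \<Rightarrow> nat \<Rightarrow> complex) \<Rightarrow> nat \<Rightarrow> nat \<Rightarrow> complex"
  where "replace_row j v A k l = (if k = j then v l else if l = j then - v k else A k l)"

text \<open>A summand of the pfaffian contains exactly one entry with an index equal to \<open>j\<close>, and that entry
  depends linearly on the new row.\<close>

lemma pfaff_row_linear:
  assumes j: "j \<in> {1..2 * r}"
  shows "pfaff r (replace_row j (\<lambda>k. u k + c * v k) A) =
         pfaff r (replace_row j u A) + c * pfaff r (replace_row j v A)"
proof -
  have "(\<Prod>i\<in>{1..r}. replace_row j (\<lambda>k. u k + c * v k) A (\<sigma> (2 * i - 1)) (\<sigma> (2 * i))) =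
    (\<Prod>i\<in>{1..r}. replace_row j u A (\<sigma> (2 * i - 1)) (\<sigma> (2 * i))) +
    c * (\<Prod>i\<in>{1..r}. replace_row j v A (\<sigma> (2 * i - 1)) (\<sigma> (2 * i)))"
    if \<sigma>: "\<sigma> permutes {1..2 * r}" for \<sigma>
  proof -
    obtain t where t: "\<sigma> t = j" "t \<in> {1..2 * r}"
      using j \<sigma> by (metis permutes_in_image permutes_surj surj_def)
    \<comment> \<open>The position \<open>t\<close> of \<open>j\<close> lies in the \<open>i\<close>-th pair of positions.\<close>
    define i where "i = (t + 1) div 2"
    have i: "i \<in> {1..r}" "t = 2 * i - 1 \<or> t = 2 * i"
      using t(2) by (auto simp: i_def)
    have inj: "\<sigma> a = j \<longleftrightarrow> a = t" for a
      using t(1) permutes_inj[OF \<sigma>] by (auto dest: injD)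
    let ?f = "\<lambda>w i. replace_row j w A (\<sigma> (2 * i - 1)) (\<sigma> (2 * i))"
    have rest: "(\<Prod>l\<in>{1..r} - {i}. ?f w l) = (\<Prod>l\<in>{1..r} - {i}. A (\<sigma> (2 * l - 1)) (\<sigma> (2 * l)))" for w
      using i by (intro prod.cong) (auto simp: replace_row_def inj)
    have split: "(\<Prod>l\<in>{1..r}. ?f w l) = ?f w i * (\<Prod>l\<in>{1..r} - {i}. A (\<sigma> (2 * l - 1)) (\<sigma> (2 * l)))" for w
      using i(1) rest[of w] by (subst prod.remove[of _ i]) auto
    have "?f (\<lambda>k. u k + c * v k) i = ?f u i + c * ?f v i"
      using i by (auto simp: replace_row_def inj algebra_simps)
    then show ?thesis by (simp only: split) (simp add: algebra_simps)
  qed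
  then have "(\<Sum>\<sigma> | \<sigma> permutes {1..2 * r}. of_int (sign \<sigma>) *
      (\<Prod>i\<in>{1..r}. replace_row j (\<lambda>k. u k + c * v k) A (\<sigma> (2 * i - 1)) (\<sigma> (2 * i)))) =
    (\<Sum>\<sigma> | \<sigma> permutes {1..2 * r}. of_int (sign \<sigma>) *
      (\<Prod>i\<in>{1..r}. replace_row j u A (\<sigma> (2 * i - 1)) (\<sigma> (2 * i))) + c * (of_int (sign \<sigma>) *
      (\<Prod>i\<in>{1..r}. replace_row j v A (\<sigma> (2 * i - 1)) (\<sigma> (2 * i)))))"
    by (intro sum.cong refl) (simp only: mem_Collect_eq distrib_left mult.left_commute)
  then show ?thesis
    unfolding pfaff_def by (simp only: sum.distrib sum_distrib_left[symmetric] distrib_left mult.left_commute)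
qed

lemma pfaff_replace_by_other_row:
  assumes "\<And>k l. A l k = - A k l" and "i \<in> {1..2 * r}" "j \<in> {1..2 * r}" "i \<noteq> j"
  shows "pfaff r (replace_row j (A i) A) = 0"
proof -
  have diag: "A i i = 0" using assms(1)[of i i] by simp
  show ?thesis
  proof (rule pfaff_equal_rows[OF assms(2-4)])
    fix k assume "k \<noteq> i" "k \<noteq> j"
    then show "replace_row j (A i) A i k = replace_row j (A i) A j k \<and>
        replace_row j (A i) A k i = replace_row j (A i) A k j"
      using assms(1)[of i k] assms(4) by (simp add: replace_row_def)
  qed (use diag assms(4) in \<open>simp_all add: replace_row_def\<close>)
qed

lemma pfaff_add_two_rows:
  assumes skew: "\<And>k l. A l k = - A k l"
    and "j \<in> {1..2 * r}" "p \<in> {1..2 * r}" "p' \<in> {1..2 * r}" "p \<noteq> j" "p' \<noteq> j"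
  shows "pfaff r (replace_row j (\<lambda>k. A j k + a * A p k + b * A p' k) A) = pfaff r A"
proof -
  have "replace_row j (A j) A k l = A k l" for k l
    using skew[of j k] by (simp add: replace_row_def)
  then have "replace_row j (A j) A = A" by blast
  moreover have "pfaff r (replace_row j (A p) A) = 0" "pfaff r (replace_row j (A p') A) = 0"
    using assms by (blast intro: pfaff_replace_by_other_row)+
  ultimately show ?thesis
    using assms(2) by (simp only: pfaff_row_linear) simp
qed

definition pfaff_summand :: "nat \<Rightarrow> (nat \<Rightarrow> nat \<Rightarrow> complex) \<Rightarrow> (nat \<Rightarrow> nat) \<Rightarrow> complex"
  where "pfaff_summand r A \<sigma> = of_int (sign \<sigma>) * (\<Prod>l\<in>{1..r}. A (\<sigma> (2 * l - 1)) (\<sigma> (2 * l)))"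

lemma pfaff_eq_sum_summands:
  "pfaff r A = (\<Sum>\<sigma> | \<sigma> permutes {1..2 * r}. pfaff_summand r A \<sigma>) / (2 ^ r * fact r)"
  by (simp add: pfaff_def pfaff_summand_def)

lemma pair_index_simps:
  fixes k l :: nat
  assumes "k \<ge> 1" "l \<ge> 1"
  shows "2 * k - 1 = 2 * l - 1 \<longleftrightarrow> k = l" "2 * k - 1 \<noteq> 2 * l" "2 * k \<noteq> 2 * l - 1"
  using assms by presburger+

text \<open>The two lemmas that follow express that the summand of \<open>\<sigma>\<close> depends only on the perfect matching formed by
  the pairs \<open>{\<sigma>(2l-1), \<sigma>(2l)}\<close>. For the first, the sign of \<open>\<sigma>\<close> and one entry both change sign.\<close>

lemma pfaff_summand_swap_in_pair:
  assumes skew: "\<And>k l. A l k = - A k l" and \<sigma>: "\<sigma> permutes {1..2 * r}" and i: "i \<in> {1..r}"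
  shows "pfaff_summand r A (\<sigma> \<circ> transpose (2 * i - 1) (2 * i)) = pfaff_summand r A \<sigma>"
proof -
  let ?t = "transpose (2 * i - 1) (2 * i)"
  have sg: "sign (\<sigma> \<circ> ?t) = - sign \<sigma>"
    using pair_index_simps(2)[of i i] i
    by (simp add: sign_compose[OF permutes_imp_permutation[OF _ \<sigma>] permutation_swap_id] sign_swap_id
        del: One_nat_def)
  have rest: "(\<Prod>l\<in>{1..r} - {i}. A ((\<sigma> \<circ> ?t) (2 * l - 1)) ((\<sigma> \<circ> ?t) (2 * l))) =
      (\<Prod>l\<in>{1..r} - {i}. A (\<sigma> (2 * l - 1)) (\<sigma> (2 * l)))"
  proof (rule prod.cong[OF refl])
    fix l assume "l \<in> {1..r} - {i}"
    then have "l \<ge> 1" "i \<ge> 1" "l \<noteq> i" using i by auto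
    note this(3) pair_index_simps[OF this(1,2)]
    then show "A ((\<sigma> \<circ> ?t) (2 * l - 1)) ((\<sigma> \<circ> ?t) (2 * l)) = A (\<sigma> (2 * l - 1)) (\<sigma> (2 * l))"
      by (simp add: transpose_def del: One_nat_def)
  qed
  have "A ((\<sigma> \<circ> ?t) (2 * i - 1)) ((\<sigma> \<circ> ?t) (2 * i)) = - A (\<sigma> (2 * i - 1)) (\<sigma> (2 * i))"
    using skew[of "\<sigma> (2 * i - 1)"] by simp
  then show ?thesis
    unfolding pfaff_summand_def sg prod.remove[OF finite_atLeastAtMost i] rest by simp
qed

text \<open>The permutation of positions is a product of two transpositions and hence even, and it permutes
  the factors.\<close>

lemma pfaff_summand_swap_pairs:
  assumes \<sigma>: "\<sigma> permutes {1..2 * r}" and i: "i \<in> {1..r}" "i' \<in> {1..r}"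
  shows "pfaff_summand r A (\<sigma> \<circ> (transpose (2 * i - 1) (2 * i' - 1) \<circ> transpose (2 * i) (2 * i'))) =
    pfaff_summand r A \<sigma>"
proof -
  let ?t = "transpose (2 * i - 1) (2 * i' - 1) \<circ> transpose (2 * i) (2 * i')"
  have "2 * i - 1 = 2 * i' - 1 \<longleftrightarrow> i = i'" using i by auto
  then have "sign ?t = 1"
    by (simp only: sign_compose[OF permutation_swap_id permutation_swap_id] sign_swap_id) simp
  then have sg: "sign (\<sigma> \<circ> ?t) = sign \<sigma>"
    using sign_compose[OF permutes_imp_permutation[OF _ \<sigma>]
        permutation_compose[OF permutation_swap_id permutation_swap_id]] by simp
  have t: "?t (2 * l - 1) = 2 * transpose i i' l - 1" "?t (2 * l) = 2 * transpose i i' l"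
    if "l \<in> {1..r}" for l
  proof -
    have "l \<ge> 1" "i \<ge> 1" "i' \<ge> 1" using that i by auto
    note pair_index_simps[OF this(1,2)] pair_index_simps[OF this(1,3)]
      pair_index_simps[OF this(2,2)] pair_index_simps[OF this(3,3)]
      pair_index_simps[OF this(2,3)] pair_index_simps[OF this(3,2)]
    then show "?t (2 * l - 1) = 2 * transpose i i' l - 1" "?t (2 * l) = 2 * transpose i i' l"
      by (auto simp: transpose_def simp del: One_nat_def)
  qed
  have "(\<Prod>l\<in>{1..r}. A ((\<sigma> \<circ> ?t) (2 * l - 1)) ((\<sigma> \<circ> ?t) (2 * l))) =
    (\<Prod>l\<in>{1..r}. A (\<sigma> (2 * transpose i i' l - 1)) (\<sigma> (2 * transpose i i' l)))"
    by (intro prod.cong refl) (simp only: comp_apply[of \<sigma>] t)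
  also have "\<dots> = (\<Prod>l\<in>{1..r}. A (\<sigma> (2 * l - 1)) (\<sigma> (2 * l)))"
    using prod.permute[OF permutes_swap_id[OF i], of "\<lambda>l. A (\<sigma> (2 * l - 1)) (\<sigma> (2 * l))"]
    unfolding o_def by (rule sym)
  finally show ?thesis unfolding pfaff_summand_def sg by simp
qed

section \<open>Elimination of the last two rows\<close>

text \<open>The partner of \<open>2r + 2\<close> in a matching with nonzero summand can only be \<open>2r + 1\<close>.\<close>

lemma pfaff_summand_fix_last:
  assumes last: "\<And>k. k \<in> {1..2 * r} \<Longrightarrow> A k (2 * r + 2) = 0"
    and \<sigma>: "\<sigma> permutes {1..2 * Suc r}" and fix1: "\<sigma> (2 * r + 2) = 2 * r + 2"
    and nz: "pfaff_summand (Suc r) A \<sigma> \<noteq> 0"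
  shows "\<sigma> permutes {1..2 * r}"
proof -
  have "\<sigma> (2 * r + 1) \<in> {1..2 * Suc r}"
    using \<sigma> by (subst permutes_in_image) auto
  moreover have "\<sigma> (2 * r + 1) \<noteq> \<sigma> (2 * r + 2)"
    using inj_eq[OF permutes_inj[OF \<sigma>]] by simp
  moreover have "A (\<sigma> (2 * r + 1)) (2 * r + 2) \<noteq> 0"
    using nz fix1 by (auto simp: pfaff_summand_def)
  ultimately have "\<sigma> (2 * r + 1) = 2 * r + 1"
    using last[of "\<sigma> (2 * r + 1)"] fix1 by force
  with fix1 show ?thesis
    by (intro permutes_superset[OF \<sigma>]) (auto simp: le_Suc_eq)
qed

text \<open>All \<open>2r + 2\<close> positions of the last index contribute equally, by the symmetries of the summands.
  Placing it in the last position leaves the summands of the smaller pfaffian, and the factor \<open>2r + 2\<close>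
  accounts for the change of the normalisation \<open>2\<^sup>r r!\<close>.\<close>

lemma pfaff_split_off_last_pair:
  assumes skew: "\<And>k l. A l k = - A k l"
    and last: "\<And>k. k \<in> {1..2 * r} \<Longrightarrow> A k (2 * r + 2) = 0"
  shows "pfaff (Suc r) A = A (2 * r + 1) (2 * r + 2) * pfaff r A"
proof -
  let ?S = "{1..2 * Suc r}" and ?e = "2 * r + 2" and ?T = "pfaff_summand (Suc r) A"
  let ?fixed = "\<Sum>\<sigma> | \<sigma> permutes ?S. if \<sigma> ?e = ?e then ?T \<sigma> else 0"
  have position: "(\<Sum>\<sigma> | \<sigma> permutes ?S. if \<sigma> k = ?e then ?T \<sigma> else 0) = ?fixed" if k: "k \<in> ?S" for k
  proof -
    \<comment> \<open>A symmetry of the summands that moves position \<open>2r + 2\<close> to position \<open>k\<close>.\<close>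
    have "\<exists>\<tau>. \<tau> permutes ?S \<and> \<tau> ?e = k \<and> (\<forall>\<sigma>. \<sigma> permutes ?S \<longrightarrow> ?T (\<sigma> \<circ> \<tau>) = ?T \<sigma>)"
    proof -
      define i where "i = (k + 1) div 2"
      have i: "i \<in> {1..Suc r}" "k = 2 * i - 1 \<or> k = 2 * i"
        using k by (auto simp: i_def)
      define \<rho> where "\<rho> = transpose (2 * i - 1) (2 * Suc r - 1) \<circ> transpose (2 * i) (2 * Suc r)"
      define \<kappa> where "\<kappa> = transpose (2 * i - 1) (2 * i)"
      have \<rho>: "\<rho> permutes ?S"
        unfolding \<rho>_def using i by (intro permutes_compose permutes_swap_id) auto
      have "1 \<le> i" "1 \<le> Suc r" using i by auto
      note pair_index_simps(3)[OF this(1,1)] pair_index_simps(3)[OF this]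
      then have \<rho>e: "\<rho> ?e = 2 * i"
        by (simp add: \<rho>_def transpose_def del: One_nat_def)
      have \<kappa>: "\<kappa> permutes ?S" "\<kappa> (2 * i) = 2 * i - 1"
        unfolding \<kappa>_def using i by (auto intro!: permutes_swap_id)
      have T\<rho>: "?T (\<sigma> \<circ> \<rho>) = ?T \<sigma>" if "\<sigma> permutes ?S" for \<sigma>
        unfolding \<rho>_def using that i by (intro pfaff_summand_swap_pairs) auto
      have T\<kappa>: "?T (\<sigma> \<circ> \<kappa>) = ?T \<sigma>" if "\<sigma> permutes ?S" for \<sigma>
        unfolding \<kappa>_def using that i by (intro pfaff_summand_swap_in_pair skew) auto
      show ?thesis
      proof (cases "k = 2 * i")
        case True
        then show ?thesis using \<rho> \<rho>e T\<rho> by blast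
      next
        case False
        have "?T (\<sigma> \<circ> (\<kappa> \<circ> \<rho>)) = ?T \<sigma>" if "\<sigma> permutes ?S" for \<sigma>
          using T\<rho>[OF permutes_compose[OF \<kappa>(1) that]] T\<kappa>[OF that] by (simp add: o_assoc)
        moreover have "(\<kappa> \<circ> \<rho>) ?e = k" using False i(2) \<rho>e \<kappa>(2) by simp
        ultimately show ?thesis using permutes_compose[OF \<rho> \<kappa>(1)] by blast
      qed
    qed
    then obtain \<tau> where \<tau>: "\<tau> permutes ?S" "\<tau> ?e = k" "\<And>\<sigma>. \<sigma> permutes ?S \<Longrightarrow> ?T (\<sigma> \<circ> \<tau>) = ?T \<sigma>"
      by blast
    have "inv \<tau> permutes ?S" "inv \<tau> k = ?e"
      using permutes_inv[OF \<tau>(1)] permutes_inverses(2)[OF \<tau>(1), of ?e] \<tau>(2) by simp_all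
    have Tinv: "?T (\<sigma> \<circ> inv \<tau>) = ?T \<sigma>" if "\<sigma> permutes ?S" for \<sigma>
      using \<tau>(3)[OF permutes_compose[OF permutes_inv[OF \<tau>(1)] that]] permutes_inv_o(2)[OF \<tau>(1)]
      by (simp add: o_assoc[symmetric])
    show ?thesis
      by (subst sum_permutations_compose_right[OF \<open>inv \<tau> permutes ?S\<close>])
        (rule sum.cong; simp add: \<open>inv \<tau> k = ?e\<close> Tinv)
  qed
  have "(\<Sum>\<sigma> | \<sigma> permutes ?S. ?T \<sigma>) =
      (\<Sum>\<sigma> | \<sigma> permutes ?S. \<Sum>k\<in>?S. if \<sigma> k = ?e then ?T \<sigma> else 0)"
  proof (rule sum.cong[OF refl])
    fix \<sigma> assume "\<sigma> \<in> {\<sigma>. \<sigma> permutes ?S}"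
    then have \<sigma>: "\<sigma> permutes ?S" by simp
    have "\<sigma> k = ?e \<longleftrightarrow> k = inv \<sigma> ?e" for k
      using permutes_inv_eq[OF \<sigma>] by metis
    moreover have "inv \<sigma> ?e \<in> ?S"
      by (subst permutes_in_image[OF permutes_inv[OF \<sigma>]]) auto
    ultimately show "?T \<sigma> = (\<Sum>k\<in>?S. if \<sigma> k = ?e then ?T \<sigma> else 0)" by simp
  qed
  also have "\<dots> = (\<Sum>k\<in>?S. \<Sum>\<sigma> | \<sigma> permutes ?S. if \<sigma> k = ?e then ?T \<sigma> else 0)"
    by (rule sum.swap)
  also have "\<dots> = (\<Sum>k\<in>?S. ?fixed)"
    by (rule sum.cong[OF refl position])
  also have "\<dots> = of_nat (2 * Suc r) * ?fixed"
    by (simp only: sum_constant) simp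
  also have "?fixed = (\<Sum>\<sigma> | \<sigma> permutes {1..2 * r}. ?T \<sigma>)"
  proof (rule sum.mono_neutral_cong_right)
    show "finite {\<sigma>. \<sigma> permutes ?S}" by (simp add: finite_permutations)
    show "{\<sigma>. \<sigma> permutes {1..2 * r}} \<subseteq> {\<sigma>. \<sigma> permutes ?S}"
      by (auto intro: permutes_subset)
    show "\<forall>\<sigma>\<in>{\<sigma>. \<sigma> permutes ?S} - {\<sigma>. \<sigma> permutes {1..2 * r}}. (if \<sigma> ?e = ?e then ?T \<sigma> else 0) = 0"
      using pfaff_summand_fix_last[of r A] last by auto
  qed (simp add: permutes_def)
  also have "\<dots> = A (2 * r + 1) (2 * r + 2) * (\<Sum>\<sigma> | \<sigma> permutes {1..2 * r}. pfaff_summand r A \<sigma>)"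
    by (simp add: pfaff_summand_def sum_distrib_left permutes_def mult_ac)
  finally have "(\<Sum>\<sigma> | \<sigma> permutes ?S. ?T \<sigma>) = 2 * of_nat (Suc r) *
      (A (2 * r + 1) (2 * r + 2) * (\<Sum>\<sigma> | \<sigma> permutes {1..2 * r}. pfaff_summand r A \<sigma>))"
    by (simp only: of_nat_mult of_nat_numeral)
  then show ?thesis
    unfolding pfaff_eq_sum_summands by (simp add: divide_simps del: of_nat_Suc)
qed

text \<open>Adding suitable multiples of the last two rows and columns to the others clears the last two rows
  outside the pivot block, so that this block splits off. What remains is the Schur complement of the
  block.\<close>

lemma pfaff_eliminate_last_pair:
  assumes skew: "\<And>k l. A l k = - A k l"
    and p: "p = 2 * r + 1" "p' = 2 * r + 2" and pivot: "A p p' \<noteq> 0"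
  shows "pfaff (Suc r) A = A p p' * pfaff r (\<lambda>i j. A i j - (A p i * A p' j - A p j * A p' i) / A p p')"
proof -
  \<comment> \<open>The coefficients with which rows \<open>p\<close> and \<open>p'\<close> are added to row \<open>i\<close>.\<close>
  define a b where "a J i = (if i \<in> J then A p' i / A p p' else 0)"
    and "b J i = (if i \<in> J then - A p i / A p p' else 0)" for J :: "nat set" and i
  \<comment> \<open>\<open>M J\<close> is the matrix in which only the rows in \<open>J\<close> have been reduced; the last term is the part of
    second order, which appears because rows and columns are reduced simultaneously.\<close>
  define M where "M J i j = A i j + a J i * A p j + b J i * A p' j - a J j * A p i - b J j * A p' i
    + (a J i * b J j - b J i * a J j) * A p p'" for J i j
  have diag: "A i i = 0" for i using skew[of i i] by simp
  have M_skew: "M J j i = - M J i j" for J i j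
    unfolding M_def using skew[of i j] by (simp add: algebra_simps)
  have step: "pfaff (Suc r) (M (insert j J)) = pfaff (Suc r) (M J)"
    if "j \<in> {1..2 * r}" "J \<subseteq> {1..2 * r}" "j \<notin> J" for j J
  proof -
    let ?R = "replace_row j (\<lambda>k. M J j k + a {j} j * M J p k + b {j} j * M J p' k) (M J)"
    have pJ: "p \<notin> J" "p' \<notin> J" using that p by auto
    have row: "M (insert j J) j k = M J j k + a {j} j * M J p k + b {j} j * M J p' k" if "k \<noteq> j" for k
      using that \<open>j \<notin> J\<close> pJ skew[of p p'] by (simp add: M_def a_def b_def diag algebra_simps)
    have "M (insert j J) k l = ?R k l" if "k \<noteq> l" for k l
    proof -
      consider "k = j" | "l = j" | "k \<noteq> j" "l \<noteq> j" by blast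
      then show ?thesis
      proof cases
        case 2
        have "M (insert j J) k j = - M (insert j J) j k" by (rule M_skew)
        then show ?thesis using 2 that row[of k] by (simp add: replace_row_def)
      qed (use that row in \<open>auto simp: replace_row_def M_def a_def b_def\<close>)
    qed
    then have "pfaff (Suc r) (M (insert j J)) = pfaff (Suc r) ?R"
      by (intro pfaff_cong)
    also have "\<dots> = pfaff (Suc r) (M J)"
      using that p by (intro pfaff_add_two_rows M_skew) auto
    finally show ?thesis .
  qed
  have "pfaff (Suc r) (M J) = pfaff (Suc r) (M {})" if "J \<subseteq> {1..2 * r}" for J
    using finite_subset[OF that finite_atLeastAtMost] that
    by (induction J rule: finite_induct) (auto simp: step)
  moreover have "M {} = A" by (simp add: fun_eq_iff M_def a_def b_def)
  ultimately have "pfaff (Suc r) A = pfaff (Suc r) (M {1..2 * r})" by simp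
  also have "\<dots> = M {1..2 * r} p p' * pfaff r (M {1..2 * r})"
    unfolding p
  proof (rule pfaff_split_off_last_pair[OF M_skew])
    fix k assume "k \<in> {1..2 * r}"
    then show "M {1..2 * r} k (2 * r + 2) = 0"
      using p pivot skew[of k p'] diag by (simp add: M_def a_def b_def)
  qed
  also have "M {1..2 * r} p p' = A p p'"
    using p by (simp add: M_def a_def b_def)
  also have "pfaff r (M {1..2 * r}) = pfaff r (\<lambda>i j. A i j - (A p i * A p' j - A p j * A p' i) / A p p')"
    using pivot by (intro pfaff_cong) (simp add: M_def a_def b_def field_simps)
  finally show ?thesis .
qed

section \<open>Schur's pfaffian identity\<close>

lemma prod_pairs_Suc:
  fixes h :: "nat \<Rightarrow> nat \<Rightarrow> complex"
  shows "(\<Prod>i\<in>{1..2 * Suc r}. \<Prod>j\<in>{i<..2 * Suc r}. h i j) =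
    (\<Prod>i\<in>{1..2 * r}. \<Prod>j\<in>{i<..2 * r}. h i j) * h (2 * r + 1) (2 * r + 2) *
    (\<Prod>i\<in>{1..2 * r}. h i (2 * r + 1) * h i (2 * r + 2))"
proof -
  have "{i<..Suc n} = insert (Suc n) {i<..n}" if "i \<le> n" for i n :: nat
    using that by auto
  then have "(\<Prod>j\<in>{i<..Suc n}. h i j) = h i (Suc n) * (\<Prod>j\<in>{i<..n}. h i j)" if "i \<le> n" for i n
    using that by simp
  then have "(\<Prod>j\<in>{i<..2 * Suc r}. h i j) = h i (2 * r + 1) * h i (2 * r + 2) * (\<Prod>j\<in>{i<..2 * r}. h i j)"
    if "i \<in> {1..2 * r}" for i using that by (simp add: mult_ac)
  then have "(\<Prod>i\<in>{1..2 * r}. \<Prod>j\<in>{i<..2 * Suc r}. h i j) =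
      (\<Prod>i\<in>{1..2 * r}. h i (2 * r + 1) * h i (2 * r + 2)) * (\<Prod>i\<in>{1..2 * r}. \<Prod>j\<in>{i<..2 * r}. h i j)"
    by (simp add: prod.distrib)
  moreover have "{2 * r + 1<..2 * Suc r} = {2 * r + 2}" by auto
  moreover have "{1..2 * Suc r} = insert (2 * r + 2) (insert (2 * r + 1) {1..2 * r})" by auto
  ultimately show ?thesis by (simp add: mult_ac)
qed

lemma pfaff_0 [simp]: "pfaff 0 A = 1"
  by (simp add: pfaff_def)

text \<open>The case of four variables of Schur's identity, divided by the pivot: eliminating \<open>x\<close> and \<open>y\<close> changes
  the entry of \<open>u\<close> and \<open>v\<close> by a factor that is a product of a function of \<open>u\<close> and the same function of \<open>v\<close>.\<close>

lemma schur_complement_identity: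
  fixes x y u v :: "'a :: field"
  assumes "x \<noteq> y" "x + y \<noteq> 0" "x + u \<noteq> 0" "x + v \<noteq> 0" "y + u \<noteq> 0" "y + v \<noteq> 0" "u + v \<noteq> 0"
  shows "(v - u) / (v + u) -
      ((u - x) / (u + x) * ((v - y) / (v + y)) - (v - x) / (v + x) * ((u - y) / (u + y))) / ((y - x) / (y + x)) =
    ((x - u) / (x + u) * ((y - u) / (y + u))) * ((x - v) / (x + v) * ((y - v) / (y + v))) * ((v - u) / (v + u))"
  using assms by (simp add: divide_simps add.commute) (simp add: algebra_simps)

text \<open>Each elimination contributes the pivot and the diagonal factors, which together are exactly the
  factors of the product that involve one of the two eliminated indices. If the pivot vanishes, then the
  last two rows agree and both sides are zero.\<close>

theorem schur_pfaffian:
  assumes "\<And>i j. i \<in> {1..2 * r} \<Longrightarrow> j \<in> {1..2 * r} \<Longrightarrow> i \<noteq> j \<Longrightarrow> z i + z j \<noteq> 0"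
  shows "pfaff r (\<lambda>i j. (z j - z i) / (z j + z i)) =
    (\<Prod>i\<in>{1..2 * r}. \<Prod>j\<in>{i<..2 * r}. (z j - z i) / (z j + z i))"
  using assms
proof (induction r)
  case (Suc r)
  let ?p = "2 * r + 1" and ?p' = "2 * r + 2"
  let ?A = "\<lambda>i j. (z j - z i) / (z j + z i)"
  have skew: "?A l k = - ?A k l" for k l
    by (metis add.commute minus_diff_eq minus_divide_left)
  show ?case
  proof (cases "z ?p = z ?p'")
    case True
    then have "pfaff (Suc r) ?A = 0"
      by (intro pfaff_equal_rows[of ?p "Suc r" ?p']) auto
    with True show ?thesis unfolding prod_pairs_Suc by simp
  next
    case False
    let ?d = "\<lambda>i. ?A i ?p * ?A i ?p'"
    have nz: "z i + z j \<noteq> 0" if "i \<in> {1..2 * r} \<union> {?p, ?p'}" "j \<in> {1..2 * r} \<union> {?p, ?p'}" "i \<noteq> j" for i j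
      using that by (intro Suc.prems) auto
    have "pfaff (Suc r) ?A = ?A ?p ?p' * pfaff r (\<lambda>i j. ?A i j - (?A ?p i * ?A ?p' j - ?A ?p j * ?A ?p' i) / ?A ?p ?p')"
      using False nz[of ?p ?p'] by (intro pfaff_eliminate_last_pair skew) (auto simp: add.commute)
    also have "pfaff r (\<lambda>i j. ?A i j - (?A ?p i * ?A ?p' j - ?A ?p j * ?A ?p' i) / ?A ?p ?p') =
        pfaff r (\<lambda>i j. ?d i * ?d j * ?A i j)"
      by (intro pfaff_cong schur_complement_identity False nz) auto
    also have "\<dots> = prod ?d {1..2 * r} * pfaff r ?A"
      by (rule pfaff_scale)
    also have "pfaff r ?A = (\<Prod>i\<in>{1..2 * r}. \<Prod>j\<in>{i<..2 * r}. ?A i j)"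
      by (intro Suc.IH nz) auto
    finally show ?thesis unfolding prod_pairs_Suc by (simp only: mult_ac)
  qed
qed simp

section \<open>Pfaffians of rank-two matrices divided by sums of weights\<close>

lemma tendsto_pfaff [tendsto_intros]:
  assumes "\<And>i j. i \<in> {1..2 * r} \<Longrightarrow> j \<in> {1..2 * r} \<Longrightarrow> i \<noteq> j \<Longrightarrow> ((\<lambda>\<epsilon>. A \<epsilon> i j) \<longlongrightarrow> B i j) F"
  shows "((\<lambda>\<epsilon>. pfaff r (A \<epsilon>)) \<longlongrightarrow> pfaff r B) F"
proof -
  have "((\<lambda>\<epsilon>. A \<epsilon> (\<sigma> (2 * i - 1)) (\<sigma> (2 * i))) \<longlongrightarrow> B (\<sigma> (2 * i - 1)) (\<sigma> (2 * i))) F"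
    if "\<sigma> permutes {1..2 * r}" "i \<in> {1..r}" for \<sigma> i
  proof (rule assms)
    show "\<sigma> (2 * i - 1) \<in> {1..2 * r}" "\<sigma> (2 * i) \<in> {1..2 * r}"
      using that(2) unfolding permutes_in_image[OF that(1)] by auto
    show "\<sigma> (2 * i - 1) \<noteq> \<sigma> (2 * i)"
      using that(2) inj_eq[OF permutes_inj[OF that(1)]] by auto
  qed
  then show ?thesis
    unfolding pfaff_def by (intro tendsto_intros) auto
qed

text \<open>The Schur complement of a matrix \<open>(f\<^sub>i g\<^sub>j - f\<^sub>j g\<^sub>i) / (w\<^sub>i + w\<^sub>j)\<close> is again of this form. Here \<open>x, y\<close> are the weights
  of the eliminated indices, \<open>u, v\<close> those of the remaining ones, \<open>a, b\<close> and \<open>a', b'\<close> are the rank-two minors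
  with the first and the second eliminated index, \<open>D\<close> is the pivot minor and \<open>e\<close> the remaining one.\<close>

lemma rank_two_schur_complement:
  fixes x y u v a b a' b' D e :: complex
  assumes plucker: "D * e = a * b' - b * a'"
    and nz: "D \<noteq> 0" "x + y \<noteq> 0" "x + u \<noteq> 0" "x + v \<noteq> 0" "y + u \<noteq> 0" "y + v \<noteq> 0" "u + v \<noteq> 0"
  shows "e / (u + v) -
      (a / (x + u) * (b' / (y + v)) - b / (x + v) * (a' / (y + u))) / (D / (x + y)) =
    (a / D * (y - u) / (x + u) * (b' * (x - v) / (y + v)) -
     b / D * (y - v) / (x + v) * (a' * (x - u) / (y + u))) / (u + v)"
proof -
  \<comment> \<open>The difference of the two kernels factorises, which separates the variables \<open>u\<close> and \<open>v\<close>.\<close>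
  have key: "1 / (u + v) - (x + y) / ((x + u) * (y + v)) = (y - u) * (x - v) / ((x + u) * (y + v) * (u + v))"
    if "x + u \<noteq> 0" "y + v \<noteq> 0" "u + v \<noteq> 0" for u v :: complex
    using that by (simp add: divide_simps) (simp add: algebra_simps)
  have "e = (a * b' - b * a') / D" using plucker nz(1) by (simp add: field_simps)
  then have "e / (u + v) = a * b' / D * (1 / (u + v)) - b * a' / D * (1 / (v + u))"
    by (simp add: diff_divide_distrib add.commute[of v u])
  moreover have "(a / (x + u) * (b' / (y + v)) - b / (x + v) * (a' / (y + u))) / (D / (x + y)) =
      a * b' / D * ((x + y) / ((x + u) * (y + v))) - b * a' / D * ((x + y) / ((x + v) * (y + u)))"
    by (simp add: diff_divide_distrib right_diff_distrib left_diff_distrib mult_ac)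
  ultimately have "e / (u + v) -
      (a / (x + u) * (b' / (y + v)) - b / (x + v) * (a' / (y + u))) / (D / (x + y)) =
    a * b' / D * (1 / (u + v) - (x + y) / ((x + u) * (y + v))) -
    b * a' / D * (1 / (v + u) - (x + y) / ((x + v) * (y + u)))"
    by (simp only: right_diff_distrib) simp
  also have "\<dots> = a * b' / D * ((y - u) * (x - v) / ((x + u) * (y + v) * (u + v))) -
    b * a' / D * ((y - v) * (x - u) / ((x + v) * (y + u) * (v + u)))"
    by (simp only: key[OF nz(3,6,7)] key[OF nz(4,5) nz(7)[unfolded add.commute[of u v]]])
  also have "\<dots> = (a / D * (y - u) / (x + u) * (b' * (x - v) / (y + v)) -
     b / D * (y - v) / (x + v) * (a' * (x - u) / (y + u))) / (u + v)"
    by (simp add: diff_divide_distrib add.commute[of v u] mult_ac)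
  finally show ?thesis .
qed

definition rank_two :: "(nat \<Rightarrow> complex) \<Rightarrow> (nat \<Rightarrow> complex) \<Rightarrow> nat \<Rightarrow> nat \<Rightarrow> complex"
  where "rank_two f g i j = f i * g j - f j * g i"

lemma pfaff_rank_two_eliminate:
  fixes f g w :: "nat \<Rightarrow> complex" and p p' r :: nat
  defines "p \<equiv> 2 * r + 1" and "p' \<equiv> 2 * r + 2" and "d \<equiv> rank_two f g"
  assumes nz: "\<And>i j. i \<in> {1..2 * Suc r} \<Longrightarrow> j \<in> {1..2 * Suc r} \<Longrightarrow> i \<noteq> j \<Longrightarrow> w i + w j \<noteq> 0"
    and pivot: "d p p' \<noteq> 0"
  shows "pfaff (Suc r) (\<lambda>i j. d i j / (w i + w j)) =
    d p p' / (w p + w p') *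
    pfaff r (\<lambda>i j. rank_two (\<lambda>i. d p i / d p p' * (w p' - w i) / (w p + w i))
      (\<lambda>i. d p' i * (w p - w i) / (w p' + w i)) i j / (w i + w j))"
proof -
  let ?A = "\<lambda>i j. d i j / (w i + w j)"
  have nz': "w i + w j \<noteq> 0" if "i \<in> {1..2 * r} \<union> {p, p'}" "j \<in> {1..2 * r} \<union> {p, p'}" "i \<noteq> j" for i j
    using that by (intro nz) (auto simp: p_def p'_def)
  have "pfaff (Suc r) ?A = ?A p p' * pfaff r (\<lambda>i j. ?A i j - (?A p i * ?A p' j - ?A p j * ?A p' i) / ?A p p')"
  proof (rule pfaff_eliminate_last_pair)
    show "?A p p' \<noteq> 0" using pivot nz'[of p p'] by (simp add: p_def p'_def)
  qed (simp_all add: p_def p'_def d_def rank_two_def add.commute diff_divide_distrib)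
  also have "pfaff r (\<lambda>i j. ?A i j - (?A p i * ?A p' j - ?A p j * ?A p' i) / ?A p p') =
      pfaff r (\<lambda>i j. rank_two (\<lambda>i. d p i / d p p' * (w p' - w i) / (w p + w i))
        (\<lambda>i. d p' i * (w p - w i) / (w p' + w i)) i j / (w i + w j))"
    unfolding rank_two_def[of "\<lambda>i. _ i / _ * _ i / _ i"]
  proof (intro pfaff_cong rank_two_schur_complement pivot nz')
    fix i j show "d p p' * d i j = d p i * d p' j - d p j * d p' i"
      unfolding d_def rank_two_def by (simp add: algebra_simps)
  qed (auto simp: p_def p'_def)
  finally show ?thesis .
qed

text \<open>Elimination transforms \<open>f\<close> and \<open>g\<close> by factors like \<open>(w\<^bsub>p'\<^esub> - w\<^sub>i) / (w\<^sub>p + w\<^sub>i)\<close>. Because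
  \<open>v\<^bsub>p'\<^esub>\<^sup>2 - v\<^sub>i\<^sup>2 = w\<^bsub>p'\<^esub>\<^sup>2 - w\<^sub>i\<^sup>2\<close>, passing from \<open>w\<close> to \<open>v\<close> multiplies such a factor by
  \<open>(w\<^sub>i + w\<^sub>p) (w\<^sub>i + w\<^bsub>p'\<^esub>) / ((v\<^sub>i + v\<^sub>p) (v\<^sub>i + v\<^bsub>p'\<^esub>))\<close>, the same for \<open>f\<close> and \<open>g\<close>. It can therefore be pulled out
  of the pfaffian as a diagonal scaling, and it supplies the factors of the product that involve \<open>i\<close> and an eliminated
  index.\<close>

theorem pfaff_rank_two_change_weights:
  assumes "\<And>i j. i \<in> {1..2 * r} \<Longrightarrow> j \<in> {1..2 * r} \<Longrightarrow> i \<noteq> j \<Longrightarrow> v i + v j \<noteq> 0"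
    and "\<And>i j. i \<in> {1..2 * r} \<Longrightarrow> j \<in> {1..2 * r} \<Longrightarrow> i \<noteq> j \<Longrightarrow> w i + w j \<noteq> 0"
    and "\<And>i j. i \<in> {1..2 * r} \<Longrightarrow> j \<in> {1..2 * r} \<Longrightarrow> v i ^ 2 - v j ^ 2 = w i ^ 2 - w j ^ 2"
  shows "pfaff r (\<lambda>i j. rank_two f g i j / (v i + v j)) =
    (\<Prod>i\<in>{1..2 * r}. \<Prod>j\<in>{i<..2 * r}. (w i + w j) / (v i + v j)) *
    pfaff r (\<lambda>i j. rank_two f g i j / (w i + w j))"
  using assms
proof (induction r arbitrary: f g)
  case (Suc r)
  define p p' where p: "p = 2 * r + 1" "p' = 2 * r + 2"
  let ?c = "\<lambda>i j. (w i + w j) / (v i + v j)"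
  let ?claim = "\<lambda>f g. pfaff (Suc r) (\<lambda>i j. rank_two f g i j / (v i + v j)) =
    (\<Prod>i\<in>{1..2 * Suc r}. \<Prod>j\<in>{i<..2 * Suc r}. ?c i j) *
    pfaff (Suc r) (\<lambda>i j. rank_two f g i j / (w i + w j))"
  have nz: "v i + v j \<noteq> 0" "w i + w j \<noteq> 0"
    if "i \<in> {1..2 * r} \<union> {p, p'}" "j \<in> {1..2 * r} \<union> {p, p'}" "i \<noteq> j" for i j
    using that Suc.prems(1,2)[of i j] by (auto simp: p)
  have pivot_case: "?claim f g" if pivot: "rank_two f g p p' \<noteq> 0" for f g
  proof -
    let ?d = "rank_two f g"
    let ?F = "\<lambda>w i. ?d p i / ?d p p' * (w p' - w i) / (w p + w i)"
      and ?G = "\<lambda>w i. ?d p' i * (w p - w i) / (w p' + w i)"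
    let ?l = "\<lambda>i. ?c i p * ?c i p'"
    have transfer: "(v k - v i) / (v m + v i) = ?l i * ((w k - w i) / (w m + w i))"
      if "i \<in> {1..2 * r}" "(k, m) \<in> {(p, p'), (p', p)}" for i k m
    proof -
      have ne: "v k + v i \<noteq> 0" "v m + v i \<noteq> 0" "w m + w i \<noteq> 0"
      proof -
        have "k \<in> {p, p'}" "m \<in> {p, p'}" "k \<noteq> i" "m \<noteq> i"
          using that by (auto simp: p)
        then show "v k + v i \<noteq> 0" "v m + v i \<noteq> 0" "w m + w i \<noteq> 0"
          using that(1) by (intro nz; blast)+
      qed
      have "v k ^ 2 - v i ^ 2 = w k ^ 2 - w i ^ 2"
        using that by (intro Suc.prems(3)) (auto simp: p)
      then have "(v k - v i) * (v k + v i) = (w k + w i) * (w k - w i)"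
        by (simp add: power2_eq_square algebra_simps)
      then have "v k - v i = ?c i k * (w k - w i)"
        using ne by (simp add: field_simps)
      moreover have "1 / (v m + v i) = ?c i m / (w m + w i)"
        using ne by (simp add: add.commute[of "v m"] add.commute[of "w m"])
      ultimately have "(v k - v i) / (v m + v i) = ?c i k * (w k - w i) * (?c i m / (w m + w i))"
        by (metis mult.right_neutral times_divide_eq_right)
      then show ?thesis using that(2) by (auto simp: mult_ac)
    qed
    have FG: "?F v i = ?l i * ?F w i" "?G v i = ?l i * ?G w i" if "i \<in> {1..2 * r}" for i
      using transfer[OF that, of p' p] transfer[OF that, of p p']
      by (simp_all only: insert_iff times_divide_eq_right[symmetric] mult.left_commute[of "?l i"] simp_thms)
    have eliminate: "pfaff (Suc r) (\<lambda>i j. ?d i j / (u i + u j)) =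
        ?d p p' / (u p + u p') * pfaff r (\<lambda>i j. rank_two (?F u) (?G u) i j / (u i + u j))"
      if "\<And>i j. i \<in> {1..2 * Suc r} \<Longrightarrow> j \<in> {1..2 * Suc r} \<Longrightarrow> i \<noteq> j \<Longrightarrow> u i + u j \<noteq> 0" for u
      using pfaff_rank_two_eliminate[of r u f g] that pivot unfolding p by blast
    have "pfaff (Suc r) (\<lambda>i j. ?d i j / (v i + v j)) =
        ?d p p' / (v p + v p') * pfaff r (\<lambda>i j. rank_two (?F v) (?G v) i j / (v i + v j))"
      by (rule eliminate) (rule Suc.prems(1))
    also have "pfaff r (\<lambda>i j. rank_two (?F v) (?G v) i j / (v i + v j)) =
        pfaff r (\<lambda>i j. ?l i * ?l j * (rank_two (?F w) (?G w) i j / (v i + v j)))"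
    proof (rule pfaff_cong)
      fix i j assume ij: "i \<in> {1..2 * r}" "j \<in> {1..2 * r}"
      have "rank_two (?F v) (?G v) i j = ?l i * ?l j * rank_two (?F w) (?G w) i j"
        unfolding rank_two_def[of "?F v"] rank_two_def[of "?F w"] FG[OF ij(1)] FG[OF ij(2)]
        by (simp only: right_diff_distrib mult_ac)
      then show "rank_two (?F v) (?G v) i j / (v i + v j) =
          ?l i * ?l j * (rank_two (?F w) (?G w) i j / (v i + v j))"
        by (simp only: times_divide_eq_right)
    qed
    also have "\<dots> = prod ?l {1..2 * r} * pfaff r (\<lambda>i j. rank_two (?F w) (?G w) i j / (v i + v j))"
      by (rule pfaff_scale)
    also have "pfaff r (\<lambda>i j. rank_two (?F w) (?G w) i j / (v i + v j)) =
        (\<Prod>i\<in>{1..2 * r}. \<Prod>j\<in>{i<..2 * r}. ?c i j) * pfaff r (\<lambda>i j. rank_two (?F w) (?G w) i j / (w i + w j))"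
      by (intro Suc.IH nz Suc.prems(3)) auto
    also have "?d p p' / (v p + v p') = ?c p p' * (?d p p' / (w p + w p'))"
      using nz[of p p'] by (simp add: p)
    finally have "pfaff (Suc r) (\<lambda>i j. ?d i j / (v i + v j)) =
      ((\<Prod>i\<in>{1..2 * r}. \<Prod>j\<in>{i<..2 * r}. ?c i j) * ?c p p' * prod ?l {1..2 * r}) *
      (?d p p' / (w p + w p') * pfaff r (\<lambda>i j. rank_two (?F w) (?G w) i j / (w i + w j)))"
      by (simp only: mult_ac)
    also have "?d p p' / (w p + w p') * pfaff r (\<lambda>i j. rank_two (?F w) (?G w) i j / (w i + w j)) =
        pfaff (Suc r) (\<lambda>i j. ?d i j / (w i + w j))"
      by (rule eliminate[symmetric]) (rule Suc.prems(2))
    finally show ?thesis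
      unfolding prod_pairs_Suc p .
  qed
  show ?case
  proof (rule tendsto_unique[OF at_neq_bot])
    \<comment> \<open>Moving \<open>f\<^sub>p\<close> and \<open>g\<^bsub>p'\<^esub>\<close> turns a vanishing pivot minor into a monic quadratic polynomial in \<open>\<epsilon>\<close>.\<close>
    let ?f = "\<lambda>\<epsilon> i. f i + (if i = p then \<epsilon> else 0)" and ?g = "\<lambda>\<epsilon> i. g i + (if i = p' then \<epsilon> else 0)"
    have lim: "((\<lambda>\<epsilon>. rank_two (?f \<epsilon>) (?g \<epsilon>) i j) \<longlongrightarrow> rank_two f g i j) (at 0)" for i j
    proof -
      have "((\<lambda>\<epsilon>. ?f \<epsilon> i) \<longlongrightarrow> f i) (at 0)" "((\<lambda>\<epsilon>. ?g \<epsilon> i) \<longlongrightarrow> g i) (at 0)" for i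
        by (cases "i = p"; cases "i = p'"; auto intro!: tendsto_eq_intros)+
      then show ?thesis unfolding rank_two_def by (intro tendsto_intros)
    qed
    show "((\<lambda>\<epsilon>. pfaff (Suc r) (\<lambda>i j. rank_two (?f \<epsilon>) (?g \<epsilon>) i j / (v i + v j))) \<longlongrightarrow>
        pfaff (Suc r) (\<lambda>i j. rank_two f g i j / (v i + v j))) (at 0)"
      by (intro tendsto_intros lim Suc.prems(1))
    show "((\<lambda>\<epsilon>. pfaff (Suc r) (\<lambda>i j. rank_two (?f \<epsilon>) (?g \<epsilon>) i j / (v i + v j))) \<longlongrightarrow>
        (\<Prod>i\<in>{1..2 * Suc r}. \<Prod>j\<in>{i<..2 * Suc r}. ?c i j) *
        pfaff (Suc r) (\<lambda>i j. rank_two f g i j / (w i + w j))) (at 0)"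
    proof (cases "rank_two f g p p' = 0")
      case True
      have "eventually (\<lambda>\<epsilon>. \<epsilon> \<noteq> 0 \<and> \<epsilon> \<noteq> - (f p + g p')) (at (0 :: complex))"
        by (intro eventually_conj eventually_neq_at_within)
      then have "eventually (\<lambda>\<epsilon>. ?claim (?f \<epsilon>) (?g \<epsilon>)) (at 0)"
      proof eventually_elim
        case (elim \<epsilon>)
        have "rank_two (?f \<epsilon>) (?g \<epsilon>) p p' = \<epsilon> * (\<epsilon> + (f p + g p'))"
          using True by (simp add: rank_two_def p algebra_simps)
        also have "\<dots> \<noteq> 0" using elim by (metis eq_neg_iff_add_eq_0 mult_eq_0_iff)
        finally show ?case by (rule pivot_case)
      qed
      moreover have "((\<lambda>\<epsilon>. (\<Prod>i\<in>{1..2 * Suc r}. \<Prod>j\<in>{i<..2 * Suc r}. ?c i j) *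
          pfaff (Suc r) (\<lambda>i j. rank_two (?f \<epsilon>) (?g \<epsilon>) i j / (w i + w j))) \<longlongrightarrow>
        (\<Prod>i\<in>{1..2 * Suc r}. \<Prod>j\<in>{i<..2 * Suc r}. ?c i j) *
        pfaff (Suc r) (\<lambda>i j. rank_two f g i j / (w i + w j))) (at 0)"
        by (intro tendsto_intros lim Suc.prems(2))
      ultimately show ?thesis
        using tendsto_cong by fast
    next
      case False
      then show ?thesis unfolding pivot_case[OF False, symmetric]
        by (intro tendsto_intros lim Suc.prems(1))
    qed
  qed
qed simp

section \<open>Reduction to two variables\<close>

lemma bij_betw_PiE_permute:
  assumes "\<sigma> permutes S"
  shows "bij_betw (\<lambda>k. k \<circ> \<sigma>) (S \<rightarrow>\<^sub>E A) (S \<rightarrow>\<^sub>E A)"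
proof (rule bij_betw_byWitness[where f' = "\<lambda>k. k \<circ> inv \<sigma>"])
  have *: "k \<circ> \<tau> \<in> S \<rightarrow>\<^sub>E A" if "\<tau> permutes S" "k \<in> S \<rightarrow>\<^sub>E A" for k \<tau>
    using that by (auto simp: PiE_def extensional_def permutes_not_in permutes_in_image)
  then show "(\<lambda>k. k \<circ> \<sigma>) ` (S \<rightarrow>\<^sub>E A) \<subseteq> S \<rightarrow>\<^sub>E A" "(\<lambda>k. k \<circ> inv \<sigma>) ` (S \<rightarrow>\<^sub>E A) \<subseteq> S \<rightarrow>\<^sub>E A"
    using assms permutes_inv by blast+
qed (use permutes_inv_o[OF assms] in \<open>simp_all add: comp_assoc\<close>)

lemma sum_PiE_insert:
  assumes "x \<notin> S"
  shows "(\<Sum>k\<in>insert x S \<rightarrow>\<^sub>E A. h k) = (\<Sum>k\<in>S \<rightarrow>\<^sub>E A. \<Sum>a\<in>A. h (k(x := a)))"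
proof -
  have "inj_on (\<lambda>(y, g). g(x := y)) (A \<times> (S \<rightarrow>\<^sub>E A))"
    using inj_combinator[OF assms, of "\<lambda>_. A"] by simp
  then have "(\<Sum>k\<in>insert x S \<rightarrow>\<^sub>E A. h k) = (\<Sum>(a, k)\<in>A \<times> (S \<rightarrow>\<^sub>E A). h (k(x := a)))"
    unfolding PiE_insert_eq by (subst sum.reindex) (auto simp: case_prod_unfold)
  also have "\<dots> = (\<Sum>a\<in>A. \<Sum>k\<in>S \<rightarrow>\<^sub>E A. h (k(x := a)))"
    by (rule sum.cartesian_product[symmetric])
  finally show ?thesis by (simp add: sum.swap[of _ A])
qed

lemma sum_PiE_pairs:
  fixes F :: "nat \<Rightarrow> 'b \<Rightarrow> 'b \<Rightarrow> 'c :: comm_semiring_1"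
  shows "(\<Sum>k\<in>{1..2 * r} \<rightarrow>\<^sub>E A. \<Prod>i\<in>{1..r}. F i (k (2 * i - 1)) (k (2 * i))) =
    (\<Prod>i\<in>{1..r}. \<Sum>a\<in>A. \<Sum>b\<in>A. F i a b)"
proof (induction r)
  case (Suc r)
  have set: "{1..2 * Suc r} = insert (2 * r + 2) (insert (2 * r + 1) {1..2 * r})" by auto
  have "(\<Prod>i\<in>{1..Suc r}. F i ((k(2 * r + 1 := a, 2 * r + 2 := b)) (2 * i - 1))
      ((k(2 * r + 1 := a, 2 * r + 2 := b)) (2 * i))) =
      (\<Prod>i\<in>{1..r}. F i (k (2 * i - 1)) (k (2 * i))) * F (Suc r) a b" for k a b
  proof -
    have "(\<Prod>i\<in>{1..r}. F i ((k(2 * r + 1 := a, 2 * r + 2 := b)) (2 * i - 1))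
        ((k(2 * r + 1 := a, 2 * r + 2 := b)) (2 * i))) = (\<Prod>i\<in>{1..r}. F i (k (2 * i - 1)) (k (2 * i)))"
      by (intro prod.cong) auto
    then show ?thesis by simp
  qed
  then show ?case
    unfolding set by (subst sum_PiE_insert, simp, subst sum_PiE_insert, simp)
      (simp only: Suc.IH[symmetric] sum_distrib_left[symmetric] sum_distrib_right[symmetric] prod.cl_ivl_Suc, simp)
qed simp

definition P_coeff :: "complex \<Rightarrow> nat \<Rightarrow> nat \<Rightarrow> complex" where
  "P_coeff q n k = qpoch (-q) q k * qpoch (q powi (- int n)) q k /
     (qpoch q q k * qpoch (- (q powi (- int n))) q k)"

lemma P2_eq_double_sum:
  "P2 q n u v = (qpoch (-q) q n / qpoch q q n) ^ 2 * (\<Sum>a\<in>{0..n}. \<Sum>b\<in>{0..n}.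
     (q ^ b - q ^ a) / (q ^ b + q ^ a) * (P_coeff q n a * u ^ a) * (P_coeff q n b * v ^ b))"
proof -
  let ?h = "\<lambda>a b. (q ^ b - q ^ a) / (q ^ b + q ^ a) * (P_coeff q n a * u ^ a) * (P_coeff q n b * v ^ b)"
  have two: "(\<Prod>i\<in>{1..2}. h i) = h 1 * h 2" for h :: "nat \<Rightarrow> complex"
    by (simp add: numeral_2_eq_2)
  have inner: "{1<..2} = {2 :: nat}" "{2<..2} = ({} :: nat set)" by auto
  have "P2 q n u v = (qpoch (-q) q n / qpoch q q n) ^ 2 *
      (\<Sum>k\<in>{1..2 * 1 :: nat} \<rightarrow>\<^sub>E {0..n}. \<Prod>i\<in>{1..1}. ?h (k (2 * i - 1)) (k (2 * i)))"
    unfolding P2_def P_def P_coeff_def[symmetric] power_divide two inner by (simp add: mult_ac)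
  then show ?thesis unfolding sum_PiE_pairs[where r = 1 and F = "\<lambda>_. ?h"] by simp
qed

lemma sum_pfaff:
  "(\<Sum>k\<in>X. pfaff r (A k)) = 1 / (2 ^ r * fact r) * (\<Sum>\<sigma> | \<sigma> permutes {1..2 * r}.
     of_int (sign \<sigma>) * (\<Sum>k\<in>X. \<Prod>i\<in>{1..r}. A k (\<sigma> (2 * i - 1)) (\<sigma> (2 * i))))"
  unfolding pfaff_def sum_distrib_left by (rule sum.swap)

text \<open>Schur's identity with \<open>z\<^sub>i = q\<^bsup>k\<^sub>i\<^esup>\<close> writes the summand as a pfaffian. After relabelling the summation indices
  by \<open>\<sigma>\<close>, the summation over \<open>k\<close> acts on each pair separately.\<close>

theorem P_eq_pfaff_P2:
  assumes "\<And>a b. q ^ a + q ^ b \<noteq> 0"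
  shows "P q n (2 * r) x = pfaff r (\<lambda>i j. P2 q n (x i) (x j))"
proof -
  let ?S = "{1..2 * r}" and ?K = "qpoch (-q) q n / qpoch q q n"
  let ?t = "\<lambda>a b. (q ^ b - q ^ a) / (q ^ b + q ^ a)" and ?u = "\<lambda>i a. P_coeff q n a * x i ^ a"
  let ?G = "\<lambda>i j a b. ?u i a * ?u j b * ?t a b"
  have summand: "(\<Prod>i\<in>?S. \<Prod>j\<in>{i<..2 * r}. ?t (k i) (k j)) * (\<Prod>i\<in>?S. ?u i (k i)) =
      pfaff r (\<lambda>i j. ?G i j (k i) (k j))" for k
  proof -
    have "pfaff r (\<lambda>i j. ?G i j (k i) (k j)) = (\<Prod>i\<in>?S. ?u i (k i)) * pfaff r (\<lambda>i j. ?t (k i) (k j))"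
      by (rule pfaff_scale)
    also have "pfaff r (\<lambda>i j. ?t (k i) (k j)) = (\<Prod>i\<in>?S. \<Prod>j\<in>{i<..2 * r}. ?t (k i) (k j))"
      by (intro schur_pfaffian assms)
    finally show ?thesis by (simp only: mult.commute)
  qed
  have separate: "(\<Sum>k\<in>?S \<rightarrow>\<^sub>E {0..n}. \<Prod>i\<in>{1..r}. ?G (\<sigma> (2 * i - 1)) (\<sigma> (2 * i)) (k (\<sigma> (2 * i - 1))) (k (\<sigma> (2 * i)))) =
      (\<Prod>i\<in>{1..r}. \<Sum>a\<in>{0..n}. \<Sum>b\<in>{0..n}. ?G (\<sigma> (2 * i - 1)) (\<sigma> (2 * i)) a b)"
    if "\<sigma> permutes ?S" for \<sigma>
  proof -
    have "(\<Sum>k\<in>?S \<rightarrow>\<^sub>E {0..n}. \<Prod>i\<in>{1..r}.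
        ?G (\<sigma> (2 * i - 1)) (\<sigma> (2 * i)) (k (\<sigma> (2 * i - 1))) (k (\<sigma> (2 * i)))) =
      (\<Sum>k\<in>?S \<rightarrow>\<^sub>E {0..n}. \<Prod>i\<in>{1..r}. ?G (\<sigma> (2 * i - 1)) (\<sigma> (2 * i)) (k (2 * i - 1)) (k (2 * i)))"
      using sum.reindex_bij_betw[OF bij_betw_PiE_permute[OF that, of "{0..n}"],
        of "\<lambda>k. \<Prod>i\<in>{1..r}. ?G (\<sigma> (2 * i - 1)) (\<sigma> (2 * i)) (k (2 * i - 1)) (k (2 * i))"]
      unfolding comp_apply .
    also have "\<dots> = (\<Prod>i\<in>{1..r}. \<Sum>a\<in>{0..n}. \<Sum>b\<in>{0..n}. ?G (\<sigma> (2 * i - 1)) (\<sigma> (2 * i)) a b)"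
      by (rule sum_PiE_pairs[where F = "\<lambda>i. ?G (\<sigma> (2 * i - 1)) (\<sigma> (2 * i))"])
    finally show ?thesis .
  qed
  have "P q n (2 * r) x = ?K ^ (2 * r) *
      (\<Sum>k\<in>?S \<rightarrow>\<^sub>E {0..n}. (\<Prod>i\<in>?S. \<Prod>j\<in>{i<..2 * r}. ?t (k i) (k j)) * (\<Prod>i\<in>?S. ?u i (k i)))"
    unfolding P_def P_coeff_def power_divide by simp
  also have "\<dots> = ?K ^ (2 * r) * (\<Sum>k\<in>?S \<rightarrow>\<^sub>E {0..n}. pfaff r (\<lambda>i j. ?G i j (k i) (k j)))"
    by (simp only: summand)
  also have "(\<Sum>k\<in>?S \<rightarrow>\<^sub>E {0..n}. pfaff r (\<lambda>i j. ?G i j (k i) (k j))) =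
      pfaff r (\<lambda>i j. \<Sum>a\<in>{0..n}. \<Sum>b\<in>{0..n}. ?G i j a b)"
    unfolding sum_pfaff[where A = "\<lambda>k i j. ?G i j (k i) (k j)"]
      pfaff_def[of r "\<lambda>i j. \<Sum>a\<in>_. \<Sum>b\<in>_. ?G i j a b"]
    by (intro arg_cong2[where f = "(*)"] sum.cong refl separate) simp
  also have "?K ^ (2 * r) * \<dots> = pfaff r (\<lambda>i j. ?K * ?K * (\<Sum>a\<in>{0..n}. \<Sum>b\<in>{0..n}. ?G i j a b))"
    by (subst pfaff_scale) simp
  also have "\<dots> = pfaff r (\<lambda>i j. P2 q n (x i) (x j))"
    unfolding P2_eq_double_sum power2_eq_square by (simp only: mult_ac)
  finally show ?thesis .
qed

section \<open>A Christoffel-Darboux formula\<close>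

text \<open>If the sum vanished, then \<open>-1\<close> would be a power of \<open>q\<close>, and its square a power equal to \<open>1\<close>.\<close>

lemma power_sum_nonzero:
  fixes q :: complex
  assumes "q \<noteq> 0" and root: "\<And>N. N > 0 \<Longrightarrow> q ^ N \<noteq> 1"
  shows "q ^ a + q ^ b \<noteq> 0"
proof (induction a b rule: linorder_wlog)
  case (le a b)
  show ?case
  proof
    assume "q ^ a + q ^ b = 0"
    moreover have "q ^ b = q ^ a * q ^ (b - a)" using le by (simp flip: power_add)
    ultimately have "q ^ a * (1 + q ^ (b - a)) = 0" by (simp add: algebra_simps)
    then have neg: "q ^ (b - a) = - 1" using assms(1) by (simp add: add_eq_0_iff)
    then have "q ^ (2 * (b - a)) = 1" by (simp add: power_mult power2_eq_square mult.commute[of 2])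
    then have "\<not> 0 < 2 * (b - a)" using root by blast
    then have "b - a = 0" by simp
    with neg show False by simp
  qed
qed (simp add: add.commute)

lemma qpoch_Suc: "qpoch a q (Suc k) = qpoch a q k * (1 - a * q ^ k)"
  by (simp add: qpoch_def)

context
  fixes q :: complex and n :: nat
  assumes q0: "q \<noteq> 0" and root: "\<And>N. N > 0 \<Longrightarrow> q ^ N \<noteq> 1"
begin

lemma powi_neg_mult: "q powi (- int n) * q ^ n = 1"
  using q0 by (simp add: power_int_minus)

lemma P_coeff_Suc_n: "P_coeff q n (Suc n) = 0"
  using powi_neg_mult by (simp add: P_coeff_def qpoch_Suc)

text \<open>The ratio of consecutive coefficients, cleared of denominators and of negative powers of \<open>q\<close>. With
  \<open>z = q\<^bsup>k+1\<^esup>\<close> it is \<open>- (1 + z) (z - N) / ((1 - z) (z + N))\<close>.\<close>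

lemma P_coeff_recurrence:
  defines "N \<equiv> q ^ Suc n"
  shows "P_coeff q n (Suc k) * ((1 - q ^ Suc k) * (q ^ Suc k + N)) =
    - P_coeff q n k * ((1 + q ^ Suc k) * (q ^ Suc k - N))"
proof -
  define Q where "Q = q powi (- int n)"
  have NQ: "N * Q = q" unfolding N_def Q_def using powi_neg_mult by (simp add: mult_ac)
  have "q ^ n * (1 + Q * q ^ k) = q ^ n + q ^ k"
    using powi_neg_mult by (simp add: Q_def algebra_simps)
  then have nz: "1 + Q * q ^ k \<noteq> 0" "1 - q * q ^ k \<noteq> 0"
    using power_sum_nonzero[OF q0 root, of n k] root[of "Suc k"] by auto
  have "P_coeff q n (Suc k) = P_coeff q n k * ((1 + q * q ^ k) * (1 - Q * q ^ k)) / ((1 - q * q ^ k) * (1 + Q * q ^ k))"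
    by (simp add: P_coeff_def qpoch_Suc Q_def mult_ac)
  then have rec: "P_coeff q n (Suc k) * ((1 - q * q ^ k) * (1 + Q * q ^ k)) =
      P_coeff q n k * ((1 + q * q ^ k) * (1 - Q * q ^ k))"
    using nz by simp
  have "q ^ Suc k + N = N * (1 + Q * q ^ k)" "q ^ Suc k - N = - N * (1 - Q * q ^ k)"
    using NQ by (simp_all add: algebra_simps flip: mult.assoc)
  then show ?thesis using arg_cong[OF rec, of "\<lambda>t. N * t"] by (simp add: mult_ac)
qed

text \<open>With \<open>z = q\<^sup>k\<close>, the recurrence says that \<open>C\<^sub>k\<close> and \<open>C\<^bsub>k-1\<^esub>\<close> are \<open>e\<^sub>k\<close> times \<open>(1 + z) (z - N)\<close> and
  \<open>- (1 - z) (z + N)\<close>. These equal \<open>\<alpha> + \<beta>\<close> and \<open>\<alpha> - \<beta>\<close> with \<open>\<alpha> = z\<^sup>2 - N\<close> and \<open>\<beta> = (1 - N) z\<close>. The difference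
  of products at \<open>z = q\<^sup>a\<close> and \<open>w = q\<^sup>b\<close> is thus \<open>e\<^sub>a e\<^sub>b\<close> times \<open>2 (1 - N) (z + w) (z w - N)\<close>, which cancels the
  denominator, and \<open>(w - z) (z w - N) = z (w\<^sup>2 + N) - w (z\<^sup>2 + N)\<close> has rank two. The value \<open>0\<close> of \<open>C'\<close> at \<open>0\<close> is
  consistent with the recurrence because \<open>1 - z = 0\<close> there.\<close>

lemma P_coeff_antidiagonal_difference:
  fixes a b :: nat
  defines "N \<equiv> q ^ Suc n" and "C \<equiv> P_coeff q n"
    and "C' \<equiv> \<lambda>k. case k of 0 \<Rightarrow> 0 | Suc j \<Rightarrow> P_coeff q n j"
  defines "e \<equiv> \<lambda>k. (C k - C' k) / (2 * (1 - N) * q ^ k)"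
  shows "(q ^ b - q ^ a) / (q ^ b + q ^ a) * (C a * C b - C' a * C' b) =
    (C a - C' a) * (e b * (q ^ (2 * b) + N)) - (C b - C' b) * (e a * (q ^ (2 * a) + N))"
proof -
  have N1: "1 - N \<noteq> 0" using root[of "Suc n"] by (simp add: N_def)
  have C: "C k - C' k = 2 * (1 - N) * q ^ k * e k" "C k = e k * ((1 + q ^ k) * (q ^ k - N))"
    "C' k = - e k * ((1 - q ^ k) * (q ^ k + N))" for k
  proof -
    let ?z = "q ^ k"
    have z: "2 * (1 - N) * ?z \<noteq> 0" using N1 q0 by simp
    show diff: "C k - C' k = 2 * (1 - N) * ?z * e k" using z by (simp add: e_def)
    have rec: "C k * ((1 - ?z) * (?z + N)) = - C' k * ((1 + ?z) * (?z - N))"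
      using P_coeff_recurrence by (cases k) (simp_all add: C_def C'_def N_def)
    have split: "2 * (1 - N) * ?z = (1 + ?z) * (?z - N) + (1 - ?z) * (?z + N)"
      by (simp add: algebra_simps)
    have "2 * (1 - N) * ?z * C k = (C k - C' k) * ((1 + ?z) * (?z - N))"
      using rec unfolding split by (simp add: algebra_simps)
    then have "2 * (1 - N) * ?z * C k = 2 * (1 - N) * ?z * (e k * ((1 + ?z) * (?z - N)))"
      unfolding diff by (simp only: mult_ac)
    with z show "C k = e k * ((1 + ?z) * (?z - N))" by (simp only: mult_cancel_left) simp
    have "2 * (1 - N) * ?z * C' k = - (C k - C' k) * ((1 - ?z) * (?z + N))"
      using rec unfolding split by (simp add: algebra_simps)
    then have "2 * (1 - N) * ?z * C' k = 2 * (1 - N) * ?z * (- e k * ((1 - ?z) * (?z + N)))"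
      unfolding diff by (simp only: mult_ac minus_mult_left[symmetric] minus_mult_right[symmetric])
    with z show "C' k = - e k * ((1 - ?z) * (?z + N))" by (simp only: mult_cancel_left) simp
  qed
  have double: "q ^ (2 * k) = q ^ k * q ^ k" for k by (simp add: mult_2 power_add)
  have nz: "q ^ b + q ^ a \<noteq> 0" by (rule power_sum_nonzero[OF q0 root])
  have "C a * C b - C' a * C' b = (q ^ b + q ^ a) * (2 * (1 - N) * (e a * e b * (q ^ a * q ^ b - N)))"
    unfolding C(2,3) by (simp add: algebra_simps)
  then have "(q ^ b - q ^ a) / (q ^ b + q ^ a) * (C a * C b - C' a * C' b) =
      (q ^ b - q ^ a) * (2 * (1 - N) * (e a * e b * (q ^ a * q ^ b - N)))"
    using nz by simp
  also have "\<dots> = (C a - C' a) * (e b * (q ^ (2 * b) + N)) - (C b - C' b) * (e a * (q ^ (2 * a) + N))"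
    unfolding C(1) double by (simp add: algebra_simps)
  finally show ?thesis .
qed

text \<open>Multiplication by \<open>1 - u v\<close> takes differences of the coefficients along the diagonals, because the
  factor \<open>(q\<^sup>b - q\<^sup>a) / (q\<^sup>b + q\<^sup>a)\<close> depends on \<open>b - a\<close> only. The sums extend to \<open>n + 1\<close>, where \<open>C\<close> vanishes.\<close>

theorem P2_christoffel_darboux:
  obtains f g where "\<And>u v. (1 - u * v) * P2 q n u v = f u * g v - f v * g u"
proof -
  let ?C = "P_coeff q n" and ?C' = "\<lambda>k. case k of 0 \<Rightarrow> 0 | Suc j \<Rightarrow> P_coeff q n j"
  let ?s = "\<lambda>a b. (q ^ b - q ^ a) / (q ^ b + q ^ a)" and ?N = "q ^ Suc n"
  define F G where "F k = ?C k - ?C' k"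
    and "G k = (?C k - ?C' k) / (2 * (1 - ?N) * q ^ k) * (q ^ (2 * k) + ?N)" for k
  let ?K = "(qpoch (-q) q n / qpoch q q n) ^ 2"
  let ?f = "\<lambda>u. \<Sum>k\<le>Suc n. F k * u ^ k" and ?g = "\<lambda>u. \<Sum>k\<le>Suc n. G k * u ^ k"
  have "(1 - u * v) * P2 q n u v = ?K * ?f u * ?g v - ?K * ?f v * ?g u" for u v
  proof -
    let ?T = "\<lambda>C a b. ?s a b * (C a * C b) * (u ^ a * v ^ b)"
    let ?S = "\<Sum>a\<le>n. \<Sum>b\<le>n. ?T ?C a b"
    have "?s (Suc a) (Suc b) = ?s a b" for a b
      using q0 by (simp flip: right_diff_distrib distrib_left)
    then have "(\<Sum>a\<le>Suc n. \<Sum>b\<le>Suc n. ?T ?C' a b) = u * v * ?S"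
      unfolding sum.atMost_Suc_shift by (simp add: sum_distrib_left mult_ac)
    moreover have "(\<Sum>a\<le>Suc n. \<Sum>b\<le>Suc n. ?T ?C a b) = ?S"
      by (simp add: P_coeff_Suc_n)
    ultimately have "(1 - u * v) * ?S = (\<Sum>a\<le>Suc n. \<Sum>b\<le>Suc n. ?T ?C a b - ?T ?C' a b)"
      by (simp only: sum_subtractf left_diff_distrib mult_1)
    also have "\<dots> = (\<Sum>a\<le>Suc n. \<Sum>b\<le>Suc n. (F a * u ^ a) * (G b * v ^ b) - (F b * v ^ b) * (G a * u ^ a))"
    proof (intro sum.cong refl)
      fix a b
      have "?T ?C a b - ?T ?C' a b = ?s a b * (?C a * ?C b - ?C' a * ?C' b) * (u ^ a * v ^ b)"
        by (simp only: right_diff_distrib left_diff_distrib)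
      also have "\<dots> = (F a * G b - F b * G a) * (u ^ a * v ^ b)"
        unfolding F_def G_def P_coeff_antidiagonal_difference ..
      also have "\<dots> = (F a * u ^ a) * (G b * v ^ b) - (F b * v ^ b) * (G a * u ^ a)"
        by (simp add: algebra_simps)
      finally show "?T ?C a b - ?T ?C' a b = (F a * u ^ a) * (G b * v ^ b) - (F b * v ^ b) * (G a * u ^ a)" .
    qed
    also have "\<dots> = ?f u * ?g v - ?f v * ?g u"
      unfolding sum_subtractf sum_product by (subst (2) sum.swap) (rule refl)
    finally have S: "(1 - u * v) * ?S = ?f u * ?g v - ?f v * ?g u" .
    have "P2 q n u v = ?K * ?S"
      unfolding P2_eq_double_sum atLeast0AtMost by (simp only: mult_ac)
    then have "(1 - u * v) * P2 q n u v = ?K * ((1 - u * v) * ?S)"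
      by (simp only: mult.left_commute)
    then show ?thesis unfolding S by (simp only: right_diff_distrib mult.assoc)
  qed
  then show thesis by (rule that)
qed

end

section \<open>Changing the kernel\<close>

text \<open>The condition \<open>s\<^sub>i s\<^sub>j \<noteq> 1\<close>, also for \<open>i = j\<close>, keeps the substitution by \<open>v\<close> and \<open>w\<close> below free of poles and the
  sums \<open>v\<^sub>i + v\<^sub>j\<close>, \<open>w\<^sub>i + w\<^sub>j\<close> away from zero.\<close>

lemma pfaff_P2_change_kernel_generic:
  assumes q: "q \<noteq> 0" "\<And>N. N > 0 \<Longrightarrow> q ^ N \<noteq> 1"
    and sum: "\<And>i j. i \<in> {1..2 * r} \<Longrightarrow> j \<in> {1..2 * r} \<Longrightarrow> i \<noteq> j \<Longrightarrow> s i + s j \<noteq> 0"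
    and plus: "\<And>i j. i \<in> {1..2 * r} \<Longrightarrow> j \<in> {1..2 * r} \<Longrightarrow> i \<noteq> j \<Longrightarrow> 1 + s i * s j \<noteq> 0"
    and minus: "\<And>i j. i \<in> {1..2 * r} \<Longrightarrow> j \<in> {1..2 * r} \<Longrightarrow> s i * s j \<noteq> 1"
  shows "(\<Prod>i\<in>{1..2 * r}. \<Prod>j\<in>{i<..2 * r}. (s i + s j) / (1 + s i * s j)) *
      pfaff r (\<lambda>i j. (1 + s i * s j) / (s i + s j) * P2 q n (s i ^ 2) (s j ^ 2)) =
    pfaff r (\<lambda>i j. P2 q n (s i ^ 2) (s j ^ 2))"
proof -
  obtain f g where fg: "\<And>u v. (1 - u * v) * P2 q n u v = f u * g v - f v * g u"
    using P2_christoffel_darboux[of q n] q by metis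
  let ?S = "{1..2 * r}" and ?c = "\<lambda>i j. (1 + s i * s j) / (s i + s j)"
  define l where "l i = 1 / (1 - s i ^ 2)" for i
  define v where "v i = 2 * s i * l i" for i
  define w where "w i = (1 + s i ^ 2) * l i" for i
  let ?d = "rank_two (\<lambda>i. 2 * f (s i ^ 2)) (\<lambda>i. g (s i ^ 2))"
  have one: "1 - s i ^ 2 \<noteq> 0" "l i \<noteq> 0" "l i * (1 - s i ^ 2) = 1" if "i \<in> ?S" for i
    using minus[OF that that] by (simp_all add: l_def power2_eq_square)
  have w_sum: "w i + w j = 2 * l i * l j * ((1 - s i * s j) * (1 + s i * s j))"
    and v_sum: "v i + v j = 2 * l i * l j * ((1 - s i * s j) * (s i + s j))"
    if "i \<in> ?S" "j \<in> ?S" for i j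
    using one(1)[OF that(1)] one(1)[OF that(2)]
    by (simp_all add: w_def v_def l_def field_simps, simp_all add: algebra_simps power2_eq_square)
  have nz: "v i + v j \<noteq> 0" "w i + w j \<noteq> 0" "(w i + w j) / (v i + v j) = ?c i j"
    if "i \<in> ?S" "j \<in> ?S" "i \<noteq> j" for i j
    using sum[OF that] plus[OF that] minus[OF that(1,2)] one(2)[OF that(1)] one(2)[OF that(2)]
    unfolding v_sum[OF that(1,2)] w_sum[OF that(1,2)] by auto
  have sq: "w i ^ 2 - v i ^ 2 = 1" if "i \<in> ?S" for i
  proof -
    have "w i ^ 2 - v i ^ 2 = (l i * (1 - s i ^ 2)) ^ 2"
      by (simp add: w_def v_def power2_eq_square algebra_simps)
    then show ?thesis using one(3)[OF that] by simp
  qed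
  have P2: "P2 q n (s i ^ 2) (s j ^ 2) = l i * l j * (?d i j / (w i + w j))"
    if "i \<in> ?S" "j \<in> ?S" "i \<noteq> j" for i j
  proof -
    have "?d i j = 2 * ((1 - s i ^ 2 * s j ^ 2) * P2 q n (s i ^ 2) (s j ^ 2))"
      unfolding fg by (simp add: rank_two_def algebra_simps)
    also have "l i * l j * \<dots> = (w i + w j) * P2 q n (s i ^ 2) (s j ^ 2)"
      unfolding w_sum[OF that(1,2)] by (simp add: algebra_simps power2_eq_square)
    finally show ?thesis using nz(2)[OF that] by (simp add: field_simps)
  qed
  have "pfaff r (\<lambda>i j. ?c i j * P2 q n (s i ^ 2) (s j ^ 2)) =
      pfaff r (\<lambda>i j. l i * l j * (?d i j / (v i + v j)))"
  proof (rule pfaff_cong)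
    fix i j assume ij: "i \<in> ?S" "j \<in> ?S" "i \<noteq> j"
    show "?c i j * P2 q n (s i ^ 2) (s j ^ 2) = l i * l j * (?d i j / (v i + v j))"
      unfolding P2[OF ij] nz(3)[OF ij, symmetric] using nz(1,2)[OF ij] by simp
  qed
  also have "\<dots> = prod l ?S * pfaff r (\<lambda>i j. ?d i j / (v i + v j))"
    by (rule pfaff_scale)
  also have "pfaff r (\<lambda>i j. ?d i j / (v i + v j)) =
      (\<Prod>i\<in>?S. \<Prod>j\<in>{i<..2 * r}. (w i + w j) / (v i + v j)) * pfaff r (\<lambda>i j. ?d i j / (w i + w j))"
  proof (rule pfaff_rank_two_change_weights)
    fix i j assume "i \<in> ?S" "j \<in> ?S"
    then show "v i ^ 2 - v j ^ 2 = w i ^ 2 - w j ^ 2" using sq[of i] sq[of j] by (simp add: algebra_simps)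
  qed (use nz in blast)+
  also have "prod l ?S * \<dots> = (\<Prod>i\<in>?S. \<Prod>j\<in>{i<..2 * r}. ?c i j) * pfaff r (\<lambda>i j. l i * l j * (?d i j / (w i + w j)))"
    unfolding pfaff_scale using nz(3) by (simp add: mult.left_commute)
  also have "pfaff r (\<lambda>i j. l i * l j * (?d i j / (w i + w j))) = pfaff r (\<lambda>i j. P2 q n (s i ^ 2) (s j ^ 2))"
    by (rule pfaff_cong) (simp add: P2)
  finally have *: "pfaff r (\<lambda>i j. ?c i j * P2 q n (s i ^ 2) (s j ^ 2)) =
    (\<Prod>i\<in>?S. \<Prod>j\<in>{i<..2 * r}. ?c i j) * pfaff r (\<lambda>i j. P2 q n (s i ^ 2) (s j ^ 2))" .
  have "(\<Prod>i\<in>?S. \<Prod>j\<in>{i<..2 * r}. (s i + s j) / (1 + s i * s j)) * (\<Prod>i\<in>?S. \<Prod>j\<in>{i<..2 * r}. ?c i j) = 1"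
    unfolding prod.distrib[symmetric]
  proof (intro prod.neutral ballI)
    fix i j assume "i \<in> ?S" "j \<in> {i<..2 * r}"
    then show "(s i + s j) / (1 + s i * s j) * ?c i j = 1"
      using sum[of i j] plus[of i j] by simp
  qed
  then show ?thesis unfolding * mult.assoc[symmetric] by simp
qed

lemma tendsto_P2:
  assumes "(a \<longlongrightarrow> u) F" "(b \<longlongrightarrow> v) F"
  shows "((\<lambda>\<epsilon>. P2 q n (a \<epsilon>) (b \<epsilon>)) \<longlongrightarrow> P2 q n u v) F"
  unfolding P2_eq_double_sum by (intro tendsto_intros assms)

text \<open>The product takes the value \<open>1\<close> only at the two roots of a quadratic polynomial in \<open>\<epsilon>\<close>.\<close>

lemma eventually_shifted_product_ne_1:
  fixes a b :: complex
  shows "eventually (\<lambda>\<epsilon>. (a + \<epsilon>) * (b + \<epsilon>) \<noteq> 1) (at 0)"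
proof -
  define R where "R = csqrt (1 + ((a - b) / 2) ^ 2)"
  have "eventually (\<lambda>\<epsilon>. \<epsilon> \<noteq> R - (a + b) / 2 \<and> \<epsilon> \<noteq> - R - (a + b) / 2) (at 0)"
    by (intro eventually_conj eventually_neq_at_within)
  then show ?thesis
  proof eventually_elim
    case (elim \<epsilon>)
    have R: "R ^ 2 = 1 + ((a - b) / 2) ^ 2" by (simp add: R_def)
    have "(a + \<epsilon>) * (b + \<epsilon>) - 1 = (\<epsilon> + (a + b) / 2) ^ 2 - R ^ 2"
      unfolding R by (simp add: field_simps power2_eq_square)
    also have "\<dots> = (\<epsilon> - (R - (a + b) / 2)) * (\<epsilon> - (- R - (a + b) / 2))"
      by (simp add: algebra_simps power2_eq_square)
    finally show ?case using elim by auto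
  qed
qed

text \<open>Both sides are continuous in \<open>s\<close>, and for small \<open>\<epsilon> \<noteq> 0\<close> the shifted point \<open>s\<^sub>i + \<epsilon>\<close> is generic.\<close>

theorem pfaff_P2_change_kernel:
  assumes q: "q \<noteq> 0" "\<And>N. N > 0 \<Longrightarrow> q ^ N \<noteq> 1"
    and sum: "\<And>i j. i \<in> {1..2 * r} \<Longrightarrow> j \<in> {1..2 * r} \<Longrightarrow> i \<noteq> j \<Longrightarrow> s i + s j \<noteq> 0"
    and plus: "\<And>i j. i \<in> {1..2 * r} \<Longrightarrow> j \<in> {1..2 * r} \<Longrightarrow> i \<noteq> j \<Longrightarrow> 1 + s i * s j \<noteq> 0"
  shows "(\<Prod>i\<in>{1..2 * r}. \<Prod>j\<in>{i<..2 * r}. (s i + s j) / (1 + s i * s j)) *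
      pfaff r (\<lambda>i j. (1 + s i * s j) / (s i + s j) * P2 q n (s i ^ 2) (s j ^ 2)) =
    pfaff r (\<lambda>i j. P2 q n (s i ^ 2) (s j ^ 2))"
proof (rule tendsto_unique[OF at_neq_bot])
  let ?S = "{1..2 * r}" and ?t = "\<lambda>\<epsilon> i. s i + \<epsilon>"
  let ?lhs = "\<lambda>t. (\<Prod>i\<in>?S. \<Prod>j\<in>{i<..2 * r}. (t i + t j) / (1 + t i * t j)) *
      pfaff r (\<lambda>i j. (1 + t i * t j) / (t i + t j) * P2 q n (t i ^ 2) (t j ^ 2))"
  let ?rhs = "\<lambda>t. pfaff r (\<lambda>i j. P2 q n (t i ^ 2) (t j ^ 2))"
  have t: "((\<lambda>\<epsilon>. ?t \<epsilon> i) \<longlongrightarrow> s i) (at 0)" for i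
    by (auto intro!: tendsto_eq_intros)
  show "((\<lambda>\<epsilon>. ?lhs (?t \<epsilon>)) \<longlongrightarrow> ?lhs s) (at 0)"
    by (intro tendsto_intros t tendsto_P2 sum plus) auto
  have "eventually (\<lambda>\<epsilon>. \<forall>i\<in>?S. \<forall>j\<in>?S. ?t \<epsilon> i * ?t \<epsilon> j \<noteq> 1 \<and>
      (i \<noteq> j \<longrightarrow> ?t \<epsilon> i + ?t \<epsilon> j \<noteq> 0 \<and> 1 + ?t \<epsilon> i * ?t \<epsilon> j \<noteq> 0)) (at 0)"
  proof (intro eventually_ball_finite ballI finite_atLeastAtMost eventually_conj eventually_shifted_product_ne_1)
    fix i j assume ij: "i \<in> ?S" "j \<in> ?S"
    show "eventually (\<lambda>\<epsilon>. i \<noteq> j \<longrightarrow> ?t \<epsilon> i + ?t \<epsilon> j \<noteq> 0 \<and> 1 + ?t \<epsilon> i * ?t \<epsilon> j \<noteq> 0) (at 0)"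
    proof (cases "i = j")
      case False
      have "eventually (\<lambda>\<epsilon>. ?t \<epsilon> i + ?t \<epsilon> j \<noteq> 0) (at 0)"
        by (rule tendsto_imp_eventually_ne[OF _ sum[OF ij False]]) (intro tendsto_intros t)
      moreover have "eventually (\<lambda>\<epsilon>. 1 + ?t \<epsilon> i * ?t \<epsilon> j \<noteq> 0) (at 0)"
        by (rule tendsto_imp_eventually_ne[OF _ plus[OF ij False]]) (intro tendsto_intros t)
      ultimately show ?thesis by eventually_elim simp
    qed simp
  qed
  then have "eventually (\<lambda>\<epsilon>. ?rhs (?t \<epsilon>) = ?lhs (?t \<epsilon>)) (at 0)"
  proof eventually_elim
    case (elim \<epsilon>)
    show ?case
      by (rule pfaff_P2_change_kernel_generic[symmetric]) (use elim q in auto)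
  qed
  moreover have "((\<lambda>\<epsilon>. ?rhs (?t \<epsilon>)) \<longlongrightarrow> ?rhs s) (at 0)"
    by (intro tendsto_intros t tendsto_P2)
  ultimately show "((\<lambda>\<epsilon>. ?lhs (?t \<epsilon>)) \<longlongrightarrow> ?rhs s) (at 0)"
    using tendsto_cong by fast
qed

theorem corollary5p7:
  fixes q :: complex and n m :: nat and x s :: "nat \<Rightarrow> complex"
  assumes "q \<noteq> 0" and "\<And>N. N > 0 \<Longrightarrow> q ^ N \<noteq> 1"
    and "m \<ge> 2" and "even m"
    and "\<And>i. i \<in> {1..m} \<Longrightarrow> s i ^ 2 = x i"
    and "\<And>i j. 1 \<le> i \<Longrightarrow> i < j \<Longrightarrow> j \<le> m \<Longrightarrow> s i + s j \<noteq> 0"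
    and "\<And>i j. 1 \<le> i \<Longrightarrow> i < j \<Longrightarrow> j \<le> m \<Longrightarrow> 1 + s i * s j \<noteq> 0"
  shows "P q n m x =
    (\<Prod>i\<in>{1..m}. \<Prod>j\<in>{i<..m}. (s i + s j) / (1 + s i * s j)) *
    pfaff (m div 2) (\<lambda>i j. (1 + s i * s j) / (s i + s j) * P2 q n (x i) (x j))"
proof -
  obtain r where m: "m = 2 * r" using \<open>even m\<close> by blast
  have pairs: "s i + s j \<noteq> 0" "1 + s i * s j \<noteq> 0" if "i \<in> {1..2 * r}" "j \<in> {1..2 * r}" "i \<noteq> j" for i j
    using that assms(6,7)[of i j] assms(6,7)[of j i]
    by (auto simp: m add.commute mult.commute linorder_neq_iff)
  have "P q n m x = pfaff r (\<lambda>i j. P2 q n (x i) (x j))"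
    unfolding m by (intro P_eq_pfaff_P2 power_sum_nonzero assms(1,2))
  also have "\<dots> = pfaff r (\<lambda>i j. P2 q n (s i ^ 2) (s j ^ 2))"
    by (rule pfaff_cong) (simp add: assms(5) m)
  also have "\<dots> = (\<Prod>i\<in>{1..2 * r}. \<Prod>j\<in>{i<..2 * r}. (s i + s j) / (1 + s i * s j)) *
      pfaff r (\<lambda>i j. (1 + s i * s j) / (s i + s j) * P2 q n (s i ^ 2) (s j ^ 2))"
    by (intro pfaff_P2_change_kernel[symmetric] assms(1,2) pairs)
  also have "pfaff r (\<lambda>i j. (1 + s i * s j) / (s i + s j) * P2 q n (s i ^ 2) (s j ^ 2)) =
      pfaff r (\<lambda>i j. (1 + s i * s j) / (s i + s j) * P2 q n (x i) (x j))"
    by (rule pfaff_cong) (simp add: assms(5) m)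
  finally show ?thesis by (simp add: m)
qed

end
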